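(* Let $\mathcal{H}$ be a complex separable Hilbert space, $\Omega\subset\mathbb{C}$ a bounded connected open set, $n\ge 1$ an integer, $T\in B_n(\Omega)$, and let $P_T:\Omega\to\mathcal{L}(\mathcal{H})$ be the holomorphic curve for which $P_T(\lambda)$ is the orthogonal projection of $\mathcal{H}$ onto $\ker(T-\lambda)$ for every $\lambda\in\Omega$. Let $\{\sigma_i\}_{i=1}^\infty$ be an orthonormal basis of $\mathcal{H}$. Then for any $s,t\le n$ (non-negative integers), $$\sum_{i=1}^\infty\langle\mathscr{K}_{s,t}(P_T)\sigma_i,\sigma_i\rangle=-\operatorname{trace}\big(K_{T,z^s\overline{z}^t}\big).$$
   Context: Notation: $\partial=\partial/\partial\lambda$, $\overline{\partial}=\partial/\partial\overline{\lambda}$; $\mathcal{L}(\mathcal{H})$ is the algebra of bounded linear operators on $\mathcal{H}$. The Cowen–Douglas class $B_n(\Omega)$ is the set of $T\in\mathcal{L}(\mathcal{H})$ with $\Omega\subset\sigma(T)$, $\operatorname{Ran}(T-\lambda)=\mathcal{H}$ and $\dim\ker(T-\lambda)=n$ for every $\lambda\in\Omega$, and $\bigvee_{\lambda\in\Omega}\ker(T-\lambda)=\mathcal{H}$ ($\bigvee$ = closed linear span). $E_T$ is the Hermitian holomorphic vector bundle over $\Omega$ with fibre $\ker(T-\lambda)$; let $\alpha_1,\dots,\alpha_n:\Omega\to\mathcal{H}$ be a holomorphic frame of it and $h(\lambda)=(\langle\alpha_j(\lambda),\alpha_i(\lambda)\rangle)_{i,j=1}^n$ the metric. The curvature (as a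 matrix with respect to this frame) is $K_T=-\overline{\partial}(h^{-1}\partial h)$. Its covariant derivatives $K_{T,z^i\overline z^j}$, $i,j\ge 0$, are obtained inductively, starting from $K_{T,z^0\overline z^0}=K_T$, from the rules: the $\overline z$-derivative of $K$ is $K_{\overline z}=\overline{\partial}K$, and the $z$-derivative of $K$ is $K_{z}=\partial K+[h^{-1}\partial h,K]$; that is, $K_{T,z^i\overline{z}^{j+1}}=\overline{\partial}K_{T,z^i\overline{z}^j}$ and $K_{T,z^{i+1}\overline z^j}=\partial K_{T,z^i\overline z^j}+[h^{-1}\partial h,K_{T,z^i\overline z^j}]$. For a projection-valued holomorphic curve $P$ (a real-analytic map into the self-adjoint idempotents of $\mathcal{L}(\mathcal{H})$ with $(\overline\partial P)P=0$): $\mathscr{K}_{0,0}(P)=\overline{\partial}P\,\partial P$, $\mathscr{K}_{i+1,j}(P)=P\,\partial(\mathscr{K}_{i,j}(P))$ and $\mathscr{K}_{i,j+1}(P)=\overline{\partial}(\mathscr{K}_{i,j}(P))\,P$ for all $i,j\ge 0$. *)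

theory Defs
  imports "HOL-Analysis.Analysis"
begin

section \<open>Complex normed spaces and complex Hilbert spaces\<close>

class complex_normed_vector = real_normed_vector +
  fixes scaleC :: "complex \<Rightarrow> 'a \<Rightarrow> 'a" (infixr \<open>*\<^sub>C\<close> 75)
  assumes scaleC_add_right: "c *\<^sub>C (x + y) = c *\<^sub>C x + c *\<^sub>C y"
    and scaleC_add_left: "(c + d) *\<^sub>C x = c *\<^sub>C x + d *\<^sub>C x"
    and scaleC_scaleC: "c *\<^sub>C d *\<^sub>C x = (c * d) *\<^sub>C x"
    and scaleR_eq_scaleC: "r *\<^sub>R x = of_real r *\<^sub>C x"
    and norm_scaleC: "norm (c *\<^sub>C x) = cmod c * norm x"

lemma scaleC_one: "1 *\<^sub>C x = (x :: 'a::complex_normed_vector)"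
  using scaleR_eq_scaleC[of 1 x] by simp

(* vector_space.dim is 0 for spaces without a finite basis, so "cdim V = n" with n > 0
   includes the finite-dimensionality of V. *)
global_interpretation cvec: vector_space "scaleC :: complex \<Rightarrow> 'a \<Rightarrow> 'a::complex_normed_vector"
  defines cspan = cvec.span
    and cdependent = cvec.dependent
    and cdim = cvec.dim
  by unfold_locales (simp_all add: scaleC_add_right scaleC_add_left scaleC_scaleC scaleC_one)

(* The inner product is linear in the first argument. *)
class complex_hilbert_space = complex_normed_vector + complete_space +
  fixes cinner :: "'a \<Rightarrow> 'a \<Rightarrow> complex"
  assumes cinner_add_left: "cinner (x + y) z = cinner x z + cinner y z"
    and cinner_scaleC_left: "cinner (c *\<^sub>C x) y = c * cinner x y"
    and cinner_commute: "cinner y x = cnj (cinner x y)"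
    and cinner_self: "cinner x x = of_real ((norm x)\<^sup>2)"

definition orthonormal_basis :: "(nat \<Rightarrow> 'a::complex_hilbert_space) \<Rightarrow> bool" where
  "orthonormal_basis \<sigma> \<longleftrightarrow>
     (\<forall>i j. cinner (\<sigma> i) (\<sigma> j) = (if i = j then 1 else 0)) \<and> closure (cspan (range \<sigma>)) = UNIV"

instantiation complex :: complex_normed_vector
begin
definition scaleC_complex :: "complex \<Rightarrow> complex \<Rightarrow> complex" where
  "scaleC_complex c x = c * x"
instance
  by standard (simp_all add: scaleC_complex_def algebra_simps norm_mult scaleR_conv_of_real)
end

instantiation vec :: (complex_normed_vector, finite) complex_normed_vector
begin
definition scaleC_vec :: "complex \<Rightarrow> 'a ^ 'b \<Rightarrow> 'a ^ 'b" where
  "scaleC_vec c v = (\<chi> i. c *\<^sub>C v $ i)"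
instance
  by standard (simp_all add: scaleC_vec_def vec_eq_iff scaleC_add_right scaleC_add_left
      scaleC_scaleC scaleR_eq_scaleC norm_vec_def norm_scaleC L2_set_right_distrib)
end

lemma bounded_linear_scaleC: "bounded_linear (\<lambda>x :: 'a::complex_normed_vector. c *\<^sub>C x)"
proof
  show "c *\<^sub>C (x + y) = c *\<^sub>C x + c *\<^sub>C y" for x y :: 'a
    by (rule scaleC_add_right)
  show "c *\<^sub>C (r *\<^sub>R x) = r *\<^sub>R (c *\<^sub>C x)" for r and x :: 'a
    by (simp add: scaleR_eq_scaleC scaleC_scaleC mult.commute)
  show "\<exists>K. \<forall>x::'a. norm (c *\<^sub>C x) \<le> norm x * K"
    by (rule exI[of _ "cmod c"]) (simp add: norm_scaleC mult.commute)
qed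

instantiation blinfun :: (real_normed_vector, complex_normed_vector) complex_normed_vector
begin
definition scaleC_blinfun :: "complex \<Rightarrow> ('a \<Rightarrow>\<^sub>L 'b) \<Rightarrow> ('a \<Rightarrow>\<^sub>L 'b)" where
  "scaleC_blinfun c A = Blinfun (\<lambda>x. c *\<^sub>C blinfun_apply A x)"

lemma blinfun_apply_scaleC: "blinfun_apply (c *\<^sub>C A) x = c *\<^sub>C blinfun_apply A x"
  for A :: "'a \<Rightarrow>\<^sub>L 'b"
  unfolding scaleC_blinfun_def
  by (subst bounded_linear_Blinfun_apply)
    (auto intro: bounded_linear_compose[OF bounded_linear_scaleC blinfun.bounded_linear_right])

instance
proof
  fix A B :: "'a \<Rightarrow>\<^sub>L 'b" and c d :: complex and r :: real
  show "c *\<^sub>C (A + B) = c *\<^sub>C A + c *\<^sub>C B" "(c + d) *\<^sub>C A = c *\<^sub>C A + d *\<^sub>C A"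
    "c *\<^sub>C d *\<^sub>C A = (c * d) *\<^sub>C A" "r *\<^sub>R A = of_real r *\<^sub>C A"
    by (auto intro!: blinfun_eqI simp: blinfun_apply_scaleC plus_blinfun.rep_eq
        scaleR_blinfun.rep_eq scaleC_add_right scaleC_add_left scaleC_scaleC scaleR_eq_scaleC)
  have le: "norm (c *\<^sub>C A) \<le> cmod c * norm A" for c and A :: "'a \<Rightarrow>\<^sub>L 'b"
    by (rule norm_blinfun_bound)
      (auto simp: blinfun_apply_scaleC norm_scaleC mult.assoc intro: mult_left_mono norm_blinfun)
  show "norm (c *\<^sub>C A) = cmod c * norm A"
  proof (cases "c = 0")
    case True
    then show ?thesis using le[of c A] by simp
  next
    case False
    have "inverse c *\<^sub>C c *\<^sub>C A = A"
      using False by (intro blinfun_eqI) (simp add: blinfun_apply_scaleC scaleC_scaleC scaleC_one)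
    then have "norm A \<le> cmod (inverse c) * norm (c *\<^sub>C A)"
      using le[of "inverse c" "c *\<^sub>C A"] by simp
    then have "cmod c * norm A \<le> norm (c *\<^sub>C A)"
      using False by (simp add: norm_inverse norm_divide field_simps)
    then show ?thesis using le[of c A] by simp
  qed
qed
end


section \<open>Operators and the Cowen--Douglas class\<close>

(* L(H): the type of bounded real-linear operators carries the operator norm; the elements of
   L(H) are those that are complex-linear. *)
definition clinear_ops :: "('a::complex_normed_vector \<Rightarrow>\<^sub>L 'a) set" where
  "clinear_ops = {A. \<forall>c x. blinfun_apply A (c *\<^sub>C x) = c *\<^sub>C blinfun_apply A x}"

abbreviation op_minus :: "('a::complex_normed_vector \<Rightarrow>\<^sub>L 'a) \<Rightarrow> complex \<Rightarrow> ('a \<Rightarrow>\<^sub>L 'a)" where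
  "op_minus T z \<equiv> T - z *\<^sub>C id_blinfun"

definition spectrum :: "('a::complex_normed_vector \<Rightarrow>\<^sub>L 'a) \<Rightarrow> complex set" where
  "spectrum T = {z. \<not> (\<exists>S\<in>clinear_ops. S o\<^sub>L op_minus T z = id_blinfun \<and>
                                       op_minus T z o\<^sub>L S = id_blinfun)}"

definition eigenspace :: "('a::complex_normed_vector \<Rightarrow>\<^sub>L 'a) \<Rightarrow> complex \<Rightarrow> 'a set" where
  "eigenspace T z = {x. blinfun_apply (op_minus T z) x = 0}"

definition cowen_douglas :: "nat \<Rightarrow> complex set \<Rightarrow> ('a::complex_hilbert_space \<Rightarrow>\<^sub>L 'a) set" where
  "cowen_douglas n \<Omega> = {T \<in> clinear_ops.
     \<Omega> \<subseteq> spectrum T \<and>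
     (\<forall>z\<in>\<Omega>. range (blinfun_apply (op_minus T z)) = UNIV \<and> cdim (eigenspace T z) = n) \<and>
     closure (cspan (\<Union>z\<in>\<Omega>. eigenspace T z)) = UNIV}"

definition orthogonal_projection ::
    "('a::complex_hilbert_space \<Rightarrow>\<^sub>L 'a) \<Rightarrow> 'a set \<Rightarrow> bool" where
  "orthogonal_projection Q M \<longleftrightarrow> Q \<in> clinear_ops \<and> Q o\<^sub>L Q = Q \<and>
     (\<forall>x y. cinner (blinfun_apply Q x) y = cinner x (blinfun_apply Q y)) \<and>
     range (blinfun_apply Q) = M"


section \<open>Wirtinger derivatives\<close>

definition wirt_d ::
    "(complex \<Rightarrow> 'b::complex_normed_vector) \<Rightarrow> complex \<Rightarrow> 'b" (\<open>\<partial>\<close>) where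
  "\<partial> f z = (1/2) *\<^sub>C
     (frechet_derivative f (at z) 1 - \<i> *\<^sub>C frechet_derivative f (at z) \<i>)"

definition wirt_dbar ::
    "(complex \<Rightarrow> 'b::complex_normed_vector) \<Rightarrow> complex \<Rightarrow> 'b" (\<open>\<partial>bar\<close>) where
  "\<partial>bar f z = (1/2) *\<^sub>C
     (frechet_derivative f (at z) 1 + \<i> *\<^sub>C frechet_derivative f (at z) \<i>)"


section \<open>Holomorphic frames, metric, curvature and covariant derivatives\<close>

definition vholomorphic_on ::
    "(complex \<Rightarrow> 'b::complex_normed_vector) \<Rightarrow> complex set \<Rightarrow> bool" where
  "vholomorphic_on f S \<longleftrightarrow> (\<forall>z\<in>S. \<exists>D. (f has_derivative (\<lambda>w. w *\<^sub>C D)) (at z within S))"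

definition holomorphic_frame ::
    "('n::finite \<Rightarrow> complex \<Rightarrow> 'a::complex_hilbert_space) \<Rightarrow> ('a \<Rightarrow>\<^sub>L 'a) \<Rightarrow> complex set \<Rightarrow> bool" where
  "holomorphic_frame \<alpha> T \<Omega> \<longleftrightarrow>
     (\<forall>i. vholomorphic_on (\<alpha> i) \<Omega>) \<and>
     (\<forall>z\<in>\<Omega>. inj (\<lambda>i. \<alpha> i z) \<and> \<not> cdependent (range (\<lambda>i. \<alpha> i z)) \<and>
             cspan (range (\<lambda>i. \<alpha> i z)) = eigenspace T z)"

definition frame_metric ::
    "('n::finite \<Rightarrow> complex \<Rightarrow> 'a::complex_hilbert_space) \<Rightarrow> complex \<Rightarrow> complex ^ 'n ^ 'n" where
  "frame_metric \<alpha> z = (\<chi> i j. cinner (\<alpha> j z) (\<alpha> i z))"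

definition connection :: "(complex \<Rightarrow> complex ^ 'n ^ 'n) \<Rightarrow> complex \<Rightarrow> complex ^ 'n ^ 'n::finite" where
  "connection h z = matrix_inv (h z) ** \<partial> h z"

definition curvature :: "(complex \<Rightarrow> complex ^ 'n ^ 'n) \<Rightarrow> complex \<Rightarrow> complex ^ 'n ^ 'n::finite" where
  "curvature h z = - \<partial>bar (connection h) z"

definition commutator :: "complex ^ 'n ^ 'n \<Rightarrow> complex ^ 'n ^ 'n \<Rightarrow> complex ^ 'n ^ 'n::finite" where
  "commutator A B = A ** B - B ** A"

(* The z-rule and the zbar-rule need not commute: applied to a derivative L of the curvature K in
   the two possible orders they differ by the commutator of K and L.  Hence the two rules do not
   in general define one function of (i, j).  "cov_deriv h i j L" says that L is obtained from the
   curvature by i applications of the z-rule and j applications of the zbar-rule, in any order;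
   every convention for the order of differentiation yields such an L. *)
inductive cov_deriv ::
    "(complex \<Rightarrow> complex ^ 'n ^ 'n) \<Rightarrow> nat \<Rightarrow> nat \<Rightarrow> (complex \<Rightarrow> complex ^ 'n ^ 'n::finite) \<Rightarrow> bool"
  for h where
    base: "cov_deriv h 0 0 (curvature h)"
  | dzbar: "cov_deriv h i j K \<Longrightarrow> cov_deriv h i (Suc j) (\<lambda>z. \<partial>bar K z)"
  | dz: "cov_deriv h i j K \<Longrightarrow>
        cov_deriv h (Suc i) j (\<lambda>z. \<partial> K z + commutator (connection h z) (K z))"

(* The functions script-K_{i,j}(P); the order of the two rules matters here in the same way. *)
inductive curve_curvature ::
    "(complex \<Rightarrow> 'a::complex_hilbert_space \<Rightarrow>\<^sub>L 'a) \<Rightarrow> nat \<Rightarrow> nat \<Rightarrow> (complex \<Rightarrow> 'a \<Rightarrow>\<^sub>L 'a) \<Rightarrow> bool"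
  for P where
    base: "curve_curvature P 0 0 (\<lambda>z. \<partial>bar P z o\<^sub>L \<partial> P z)"
  | dz: "curve_curvature P i j X \<Longrightarrow> curve_curvature P (Suc i) j (\<lambda>z. P z o\<^sub>L \<partial> X z)"
  | dzbar: "curve_curvature P i j X \<Longrightarrow> curve_curvature P i (Suc j) (\<lambda>z. \<partial>bar X z o\<^sub>L P z)"

lemma cov_deriv_exists: "\<exists>K. cov_deriv h i j K"
proof (induction j)
  case 0
  show ?case by (induction i) (blast intro: cov_deriv.intros)+
qed (blast intro: cov_deriv.intros)

lemma curve_curvature_exists: "\<exists>X. curve_curvature P i j X"
proof (induction j)
  case 0
  show ?case by (induction i) (blast intro: curve_curvature.intros)+
qed (blast intro: curve_curvature.intros)

end

theory Submission
  imports Defs "HOL-Complex_Analysis.Cauchy_Integral_Formula"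
begin

text \<open>
  Write \<open>h\<close> for the metric of the frame and \<open>\<theta> = h\<^sup>-\<^sup>1 \<partial>h\<close>.  The projection is
  \<open>P = \<Sum>\<^sub>i\<^sub>j (h\<^sup>-\<^sup>1)\<^sub>i\<^sub>j \<alpha>\<^sub>i \<otimes> \<alpha>\<^sub>j\<^sup>*\<close>, and \<open>P \<partial>\<alpha>\<^sub>k = \<Sum>\<^sub>i \<theta>\<^sub>i\<^sub>k \<alpha>\<^sub>i\<close>.  With these two facts the rules for the
  functions \<open>\<K>\<^sub>i\<^sub>j(P)\<close> become, step by step, the rules for the covariant derivatives \<open>K\<close> of the
  curvature: \<open>\<K>\<^sub>i\<^sub>j(P) = - \<Sum>\<^sub>k\<^sub>l (K h\<^sup>-\<^sup>1)\<^sub>k\<^sub>l \<alpha>\<^sub>k \<otimes> \<alpha>\<^sub>l\<^sup>*\<close>, provided the derivatives are taken in the same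
  order.  By Parseval's identity the trace of this operator is \<open>- trace (K h\<^sup>-\<^sup>1 h)\<close>.  The order of the
  derivatives does not affect \<open>trace K\<close>, because commutators have trace zero and the scalar operators
  \<open>\<partial>\<close> and \<open>\<partial>bar\<close> commute.
\<close>

section \<open>Complex Hilbert spaces and rank-one operators\<close>

lemma cinner_add_right: "cinner x (y + z) = cinner x y + cinner x z"
  by (metis cinner_add_left cinner_commute complex_cnj_add)

lemma cinner_scaleC_right: "cinner x (c *\<^sub>C y) = cnj c * cinner x y"
  by (metis cinner_commute cinner_scaleC_left complex_cnj_mult)

lemma cinner_zero_left [simp]: "cinner 0 y = 0"
  using cinner_add_left[of 0 0 y] by simp

lemma cinner_zero_right [simp]: "cinner x 0 = 0"
  using cinner_add_right[of x 0 0] by simp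

lemma cinner_minus_left: "cinner (- x) y = - cinner x y"
  using cinner_add_left[of x "-x" y] by (simp add: add_eq_0_iff)

lemma cinner_diff_left: "cinner (x - y) z = cinner x z - cinner y z"
  by (simp add: diff_conv_add_uminus cinner_add_left cinner_minus_left del: add_uminus_conv_diff)

lemma cinner_diff_right: "cinner x (y - z) = cinner x y - cinner x z"
  by (metis cinner_commute cinner_diff_left complex_cnj_diff)

lemma cinner_sum_left: "cinner (sum f I) y = (\<Sum>i\<in>I. cinner (f i) y)"
  by (induction I rule: infinite_finite_induct) (simp_all add: cinner_add_left)

lemma cinner_sum_right: "cinner x (sum f I) = (\<Sum>i\<in>I. cinner x (f i))"
  by (induction I rule: infinite_finite_induct) (simp_all add: cinner_add_right)

lemma cinner_self_eq_0: "cinner x x = 0 \<longleftrightarrow> x = 0"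
  by (simp add: cinner_self)

text \<open>Cauchy-Schwarz: the component \<open>d\<close> of \<open>x\<close> orthogonal to
  \<open>y\<close> satisfies |d|^2 = |x|^2 - |<x,y>|^2 / |y|^2, and the left side is
  nonnegative.\<close>

lemma cmod_cinner_le: "cmod (cinner x y) \<le> norm x * norm y"
proof (cases "y = 0")
  case False
  define c where "c = cinner x y / cinner y y"
  define d where "d = x - c *\<^sub>C y"
  have yy: "cinner y y \<noteq> 0"
    using False by (simp add: cinner_self_eq_0)
  have dy: "cinner d y = 0"
    using yy by (simp add: d_def c_def cinner_diff_left cinner_scaleC_left)
  have "cinner y d = 0"
    using dy by (metis cinner_commute complex_cnj_zero)
  then have "cinner d d = cinner x d"
    by (subst d_def) (simp add: cinner_diff_left cinner_scaleC_left)
  also have "\<dots> = cinner x x - cnj c * cinner x y"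
    by (simp add: d_def cinner_diff_right cinner_scaleC_right)
  also have "cnj c * cinner x y = (cinner x y * cnj (cinner x y)) / of_real ((norm y)\<^sup>2)"
    by (simp add: c_def cinner_self)
  also have "\<dots> = of_real ((cmod (cinner x y))\<^sup>2 / (norm y)\<^sup>2)"
    by (simp only: complex_norm_square of_real_divide)
  finally have "complex_of_real ((norm d)\<^sup>2)
      = of_real ((norm x)\<^sup>2 - (cmod (cinner x y))\<^sup>2 / (norm y)\<^sup>2)"
    by (simp add: cinner_self)
  then have "(norm d)\<^sup>2 = (norm x)\<^sup>2 - (cmod (cinner x y))\<^sup>2 / (norm y)\<^sup>2"
    by (simp only: of_real_eq_iff)
  then have "(cmod (cinner x y))\<^sup>2 / (norm y)\<^sup>2 \<le> (norm x)\<^sup>2"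
    by (smt (verit) zero_le_power2)
  then have "(cmod (cinner x y))\<^sup>2 \<le> (norm x * norm y)\<^sup>2"
    using False by (simp add: divide_le_eq power_mult_distrib)
  then show ?thesis
    by (rule power2_le_imp_le) simp
qed simp

text \<open>Conjugate-linearity in the second argument is still real-linearity, so the real theory
  of bounded bilinear maps applies; it supplies continuity and the product rule.\<close>

lemma cinner_bounded_bilinear: "bounded_bilinear (cinner :: 'a::complex_hilbert_space \<Rightarrow> _)"
proof
  show "cinner (r *\<^sub>R x) y = r *\<^sub>R cinner x y" "cinner x (r *\<^sub>R y) = r *\<^sub>R cinner x y"
    for r and x y :: 'a
    by (simp_all add: scaleR_eq_scaleC cinner_scaleC_left cinner_scaleC_right scaleC_complex_def)
  show "\<exists>K. \<forall>x y :: 'a. norm (cinner x y) \<le> norm x * norm y * K"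
    by (rule exI[of _ 1]) (simp add: cmod_cinner_le)
qed (simp_all add: cinner_add_left cinner_add_right)

lemma scaleC_bounded_bilinear:
  "bounded_bilinear (scaleC :: complex \<Rightarrow> 'a \<Rightarrow> 'a::complex_normed_vector)"
proof
  show "(r *\<^sub>R c) *\<^sub>C x = r *\<^sub>R c *\<^sub>C x" "c *\<^sub>C r *\<^sub>R x = r *\<^sub>R c *\<^sub>C x" for r c and x :: 'a
    by (simp_all add: scaleR_eq_scaleC scaleC_scaleC scaleC_complex_def mult.commute)
  show "\<exists>K. \<forall>c (x :: 'a). norm (c *\<^sub>C x) \<le> norm c * norm x * K"
    by (rule exI[of _ 1]) (simp add: norm_scaleC)
qed (simp_all add: scaleC_add_left scaleC_add_right)

section \<open>Rank-one operators, conjugate-linear in their second vector\<close>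

definition rank_one :: "'a \<Rightarrow> 'a \<Rightarrow> 'a \<Rightarrow>\<^sub>L 'a::complex_hilbert_space" where
  "rank_one u v = Blinfun (\<lambda>x. cinner x v *\<^sub>C u)"

lemma rank_one_apply: "blinfun_apply (rank_one u v) x = cinner x v *\<^sub>C u"
  unfolding rank_one_def
  by (rule bounded_linear_Blinfun_apply[THEN fun_cong])
    (intro bounded_linear_compose[OF
        bounded_bilinear.bounded_linear_left[OF scaleC_bounded_bilinear]
        bounded_bilinear.bounded_linear_left[OF cinner_bounded_bilinear]])

lemma rank_one_add_left: "rank_one (u + u') v = rank_one u v + rank_one u' v"
  and rank_one_add_right: "rank_one u (v + v') = rank_one u v + rank_one u v'"
  and rank_one_scaleC_left: "rank_one (c *\<^sub>C u) v = c *\<^sub>C rank_one u v"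
  and rank_one_scaleC_right: "rank_one u (c *\<^sub>C v) = cnj c *\<^sub>C rank_one u v"
  by (auto intro!: blinfun_eqI simp: rank_one_apply blinfun.add_left blinfun_apply_scaleC
      scaleC_add_right scaleC_add_left cinner_add_right cinner_scaleC_right scaleC_scaleC
      mult.commute)

lemma rank_one_diff_left: "rank_one (u - u') v = rank_one u v - rank_one u' v"
  using rank_one_add_left[of "u - u'" u' v] by simp

lemma rank_one_diff_right: "rank_one u (v - v') = rank_one u v - rank_one u v'"
  using rank_one_add_right[of u "v - v'" v'] by simp

lemma rank_one_zero [simp]: "rank_one 0 v = 0" "rank_one u 0 = 0"
  by (auto intro!: blinfun_eqI simp: rank_one_apply)

lemma rank_one_sum_left: "rank_one (sum f I) v = (\<Sum>i\<in>I. rank_one (f i) v)"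
  by (induction I rule: infinite_finite_induct) (simp_all add: rank_one_add_left)

lemma rank_one_sum_right: "rank_one u (sum f I) = (\<Sum>i\<in>I. rank_one u (f i))"
  by (induction I rule: infinite_finite_induct) (simp_all add: rank_one_add_right)

lemma rank_one_bounded_bilinear:
  "bounded_bilinear (rank_one :: 'a::complex_hilbert_space \<Rightarrow> _)"
proof
  show "rank_one (r *\<^sub>R u) v = r *\<^sub>R rank_one u v" "rank_one u (r *\<^sub>R v) = r *\<^sub>R rank_one u v"
    for r and u v :: 'a
    by (simp_all add: scaleR_eq_scaleC rank_one_scaleC_left rank_one_scaleC_right)
  have "norm (rank_one u v) \<le> norm u * norm v" for u v :: 'a
  proof (rule norm_blinfun_bound)
    show "norm (blinfun_apply (rank_one u v) x) \<le> norm u * norm v * norm x" for x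
      using mult_right_mono[OF cmod_cinner_le norm_ge_zero, of x v u]
      by (simp add: rank_one_apply norm_scaleC mult.assoc mult.commute mult.left_commute)
  qed simp
  then show "\<exists>K. \<forall>u v :: 'a. norm (rank_one u v) \<le> norm u * norm v * K"
    by (intro exI[of _ 1]) simp
qed (simp_all add: rank_one_add_left rank_one_add_right)

lemma rank_one_compose: "rank_one a b o\<^sub>L rank_one c d = cinner c b *\<^sub>C rank_one a d"
  by (rule blinfun_eqI)
    (simp add: rank_one_apply blinfun_apply_scaleC cinner_scaleC_left scaleC_scaleC mult.commute)

section \<open>Parseval's identity and orthogonal projections\<close>

text \<open>The partial sums \<open>S N\<close> are linear contractions, and each vector of the span
  of the basis is eventually fixed by them. Density of the span then gives convergence of
  \<open>S N x\<close> to \<open>x\<close>, and pairing with \<open>y\<close> yields the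
  series.\<close>

lemma orthonormal_basis_parseval:
  fixes \<sigma> :: "nat \<Rightarrow> 'a::complex_hilbert_space"
  assumes "orthonormal_basis \<sigma>"
  shows "(\<lambda>m. cinner x (\<sigma> m) * cinner (\<sigma> m) y) sums cinner x y"
proof -
  have ortho: "cinner (\<sigma> i) (\<sigma> j) = (if i = j then 1 else 0)" for i j
    using assms by (simp add: orthonormal_basis_def)
  define S where "S N x = (\<Sum>m<N. cinner x (\<sigma> m) *\<^sub>C \<sigma> m)" for N x
  have S_inner: "cinner (S N x) (\<sigma> k) = (if k < N then cinner x (\<sigma> k) else 0)" for N x k
    by (simp add: S_def cinner_sum_left cinner_scaleC_left ortho if_distrib[of "\<lambda>t. _ * t"] cong: if_cong)
  have S_lin: "S N (x + y) = S N x + S N y" "S N (c *\<^sub>C x) = c *\<^sub>C S N x" for N x y c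
    by (simp_all add: S_def cinner_add_left scaleC_add_left sum.distrib cinner_scaleC_left
        scaleC_scaleC cvec.scale_sum_right)
  \<comment> \<open>\<open>S N\<close> acts as an orthogonal projection: |S N x|^2 = <x, S N x>, so
    Cauchy-Schwarz bounds one factor by |x|.\<close>
  have S_norm: "norm (S N x) \<le> norm x" for N x
  proof -
    have "cinner (S N x) (S N x) = (\<Sum>m<N. cnj (cinner x (\<sigma> m)) * cinner (S N x) (\<sigma> m))"
      by (subst (2) S_def) (simp add: cinner_sum_right cinner_scaleC_right)
    also have "\<dots> = (\<Sum>m<N. cnj (cinner x (\<sigma> m)) * cinner x (\<sigma> m))"
      by (simp add: S_inner)
    also have "\<dots> = cinner x (S N x)"
      by (simp add: S_def cinner_sum_right cinner_scaleC_right)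
    finally have "complex_of_real ((norm (S N x))\<^sup>2) = cinner x (S N x)"
      by (simp add: cinner_self)
    then have "norm (S N x) * norm (S N x) \<le> norm x * norm (S N x)"
      using cmod_cinner_le[of x "S N x"]
      by (metis norm_of_real abs_of_nonneg zero_le_power2 power2_eq_square)
    then show ?thesis
      by (metis mult_le_cancel_right norm_ge_zero norm_le_zero_iff not_le order_trans)
  qed
  have fix_\<sigma>: "\<exists>N0. \<forall>N\<ge>N0. S N y = y" if "y \<in> cspan (range \<sigma>)" for y
    using that
  proof (induction rule: cvec.span_induct_alt)
    case base
    show ?case by (simp add: S_def)
  next
    case (step c x y)
    then obtain k N0 where k: "x = \<sigma> k" and N0: "\<forall>N\<ge>N0. S N y = y"
      by auto
    have "S N (c *\<^sub>C x + y) = c *\<^sub>C x + y" if "N \<ge> max N0 (Suc k)" for N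
    proof -
      have "S N x = x"
        using that by (simp add: S_def k ortho if_distrib[of "\<lambda>t. t *\<^sub>C _"] scaleC_one cong: if_cong)
      then show ?thesis
        using N0 that by (simp add: S_lin)
    qed
    then show ?case by blast
  qed
  have "(\<lambda>N. S N x) \<longlonglongrightarrow> x"
  proof (rule LIMSEQ_I)
    fix e :: real
    assume e: "e > 0"
    have "x \<in> closure (cspan (range \<sigma>))"
      using assms by (simp add: orthonormal_basis_def)
    then obtain y where y: "y \<in> cspan (range \<sigma>)" "dist y x < e / 2"
      using e by (meson closure_approachable half_gt_zero)
    obtain N0 where N0: "\<forall>N\<ge>N0. S N y = y"
      using fix_\<sigma>[OF y(1)] by blast
    have "norm (S N x - x) < e" if "N \<ge> N0" for N
    proof -
      have "S N x = S N (x - y) + y"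
        using N0 that S_lin(1)[of N "x - y" y] by simp
      then have "norm (S N x - x) \<le> norm (S N (x - y)) + norm (y - x)"
        using norm_triangle_ineq[of "S N (x - y)" "y - x"] by (simp add: algebra_simps)
      then show ?thesis
        using S_norm[of N "x - y"] y(2) by (simp add: dist_norm norm_minus_commute)
    qed
    then show "\<exists>no. \<forall>n\<ge>no. norm (S n x - x) < e" by blast
  qed
  then have "(\<lambda>N. cinner (S N x) y) \<longlonglongrightarrow> cinner x y"
    by (rule bounded_linear.tendsto[OF bounded_bilinear.bounded_linear_left[OF cinner_bounded_bilinear]])
  then show ?thesis
    by (simp add: sums_def S_def cinner_sum_left cinner_scaleC_left)
qed

lemma projection_cinner_eq:
  assumes "orthogonal_projection Q M" "y \<in> M"
  shows "cinner (blinfun_apply Q x) y = cinner x y"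
proof -
  have "blinfun_apply Q y = y"
    using assms by (auto simp: orthogonal_projection_def simp flip: blinfun_apply_blinfun_compose)
  then show ?thesis
    using assms by (metis orthogonal_projection_def)
qed

text \<open>The difference of the two candidates lies in \<open>M\<close> and is orthogonal to all
  of \<open>M\<close>, hence to itself.\<close>

lemma projection_eqI:
  assumes Q: "orthogonal_projection Q M"
    and "y \<in> M" "\<And>m. m \<in> M \<Longrightarrow> cinner y m = cinner x m" and "\<And>u v. u \<in> M \<Longrightarrow> v \<in> M \<Longrightarrow> u - v \<in> M"
  shows "blinfun_apply Q x = y"
proof -
  let ?d = "blinfun_apply Q x - y"
  have d: "?d \<in> M"
    using Q assms by (auto simp: orthogonal_projection_def)
  have "cinner ?d ?d = 0"
    using projection_cinner_eq[OF Q d] assms(3)[OF d] by (simp add: cinner_diff_left)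
  then show ?thesis by (simp add: cinner_self_eq_0)
qed

section \<open>Wirtinger derivatives and holomorphic vectors\<close>

text \<open>One predicate holds differentiability and both Wirtinger derivatives \<open>a\<close>
  and \<open>b\<close>, so that the rules of calculus compose; \<open>b = 0\<close> expresses
  holomorphy at the point.\<close>

definition has_wirtinger ::
    "(complex \<Rightarrow> 'b::complex_normed_vector) \<Rightarrow> 'b \<Rightarrow> 'b \<Rightarrow> complex \<Rightarrow> bool" where
  "has_wirtinger f a b z \<longleftrightarrow> (f has_derivative (\<lambda>w. w *\<^sub>C a + cnj w *\<^sub>C b)) (at z)"

lemma has_wirtinger_imp:
  assumes "has_wirtinger f a b z"
  shows "\<partial> f z = a" "\<partial>bar f z = b"
proof -
  have D: "frechet_derivative f (at z) = (\<lambda>w. w *\<^sub>C a + cnj w *\<^sub>C b)"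
    using assms by (metis has_wirtinger_def frechet_derivative_at)
  show "\<partial> f z = a" "\<partial>bar f z = b"
    by (simp_all add: wirt_d_def wirt_dbar_def D scaleC_add_right scaleC_scaleC cvec.scale_minus_left
        cvec.scale_right_diff_distrib cvec.scale_left_diff_distrib cvec.scale_minus_right
        flip: scaleC_add_left)
qed

text \<open>A real-linear map on the complex numbers is determined by its values at 1 and
  \<open>\<i>\<close>; expressing Re w and Im w through w and its conjugate produces exactly the two
  Wirtinger derivatives as coefficients.\<close>

lemma has_wirtinger_differentiable:
  assumes "f differentiable (at z)"
  shows "has_wirtinger f (\<partial> f z) (\<partial>bar f z) z"
proof -
  define D where "D = frechet_derivative f (at z)"
  have D: "(f has_derivative D) (at z)"
    using assms unfolding D_def by (simp add: frechet_derivative_works)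
  then have lin: "bounded_linear D" by (rule has_derivative_bounded_linear)
  have "D w = w *\<^sub>C \<partial> f z + cnj w *\<^sub>C \<partial>bar f z" for w
  proof -
    have D_w: "D w = of_real (Re w) *\<^sub>C D 1 + of_real (Im w) *\<^sub>C D \<i>"
    proof -
      have "D w = D (Re w *\<^sub>R 1 + Im w *\<^sub>R \<i>)"
        by (rule arg_cong[of _ _ D]) (simp add: complex_eq_iff)
      also have "\<dots> = Re w *\<^sub>R D 1 + Im w *\<^sub>R D \<i>"
        using bounded_linear.linear[OF lin] by (simp only: linear_add linear_scale)
      finally show ?thesis
        by (simp only: scaleR_eq_scaleC)
    qed
    have coeffs: "of_real (Re w) = w * (1 / 2) + cnj w * (1 / 2)"
      "of_real (Im w) = cnj w * (1 / 2 * \<i>) - w * (1 / 2 * \<i>)"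
      by (simp_all add: complex_eq_iff)
    show ?thesis
      unfolding D_w coeffs
      by (simp only: wirt_d_def wirt_dbar_def scaleC_add_right scaleC_add_left scaleC_scaleC
         cvec.scale_right_diff_distrib cvec.scale_left_diff_distrib flip: D_def) simp
  qed
  then have "D = (\<lambda>w. w *\<^sub>C \<partial> f z + cnj w *\<^sub>C \<partial>bar f z)" ..
  then show ?thesis
    using D by (simp add: has_wirtinger_def)
qed

lemma has_wirtinger_imp_differentiable: "has_wirtinger f a b z \<Longrightarrow> f differentiable (at z)"
  by (auto simp: has_wirtinger_def differentiable_def)

lemma has_derivative_cong_open:
  assumes "open S" "z \<in> S" "\<And>w. w \<in> S \<Longrightarrow> f w = g w"
  shows "(f has_derivative D) (at z) \<longleftrightarrow> (g has_derivative D) (at z)"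
  using has_derivative_transform_within_open[OF _ assms(1,2), of f D UNIV g]
    has_derivative_transform_within_open[OF _ assms(1,2), of g D UNIV f] assms(3)
  by auto

text \<open>\<open>frechet_derivative\<close> is a choice from the set of derivatives at the point,
  and this set is the same for functions that agree near it. So the equalities hold even where no
  derivative exists.\<close>

lemma wirtinger_cong:
  assumes "open S" "z \<in> S" "\<And>w. w \<in> S \<Longrightarrow> f w = g w"
  shows "\<partial> f z = \<partial> g z" "\<partial>bar f z = \<partial>bar g z"
  by (simp_all only: wirt_d_def wirt_dbar_def frechet_derivative_def
      has_derivative_cong_open[of S z f g, OF assms])

lemma has_wirtinger_cong:
  assumes "open S" "z \<in> S" "\<And>w. w \<in> S \<Longrightarrow> f w = g w"
  shows "has_wirtinger f a b z \<longleftrightarrow> has_wirtinger g a b z"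
  unfolding has_wirtinger_def by (rule has_derivative_cong_open[OF assms])

section \<open>Calculus rules for pairs of Wirtinger derivatives\<close>

lemma has_wirtinger_const: "has_wirtinger (\<lambda>_. c) 0 0 z"
  by (simp add: has_wirtinger_def)

lemma has_wirtinger_add:
  assumes "has_wirtinger f a b z" "has_wirtinger g c d z"
  shows "has_wirtinger (\<lambda>w. f w + g w) (a + c) (b + d) z"
  using has_derivative_add[OF assms[unfolded has_wirtinger_def]]
  by (simp add: has_wirtinger_def scaleC_add_right add.assoc add.left_commute)

lemma has_wirtinger_uminus:
  "has_wirtinger f a b z \<Longrightarrow> has_wirtinger (\<lambda>w. - f w) (- a) (- b) z"
  unfolding has_wirtinger_def by (drule has_derivative_minus) simp

lemma has_wirtinger_sum:
  assumes "\<And>i. i \<in> I \<Longrightarrow> has_wirtinger (f i) (a i) (b i) z"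
  shows "has_wirtinger (\<lambda>w. \<Sum>i\<in>I. f i w) (sum a I) (sum b I) z"
  using assms
  by (induction I rule: infinite_finite_induct)
    (auto intro: has_wirtinger_add has_wirtinger_const)

lemma has_wirtinger_scaleC:
  assumes "has_wirtinger f a b z" "has_wirtinger g c d z"
  shows "has_wirtinger (\<lambda>w. f w *\<^sub>C g w) (a *\<^sub>C g z + f z *\<^sub>C c) (b *\<^sub>C g z + f z *\<^sub>C d) z"
  using bounded_bilinear.FDERIV[OF scaleC_bounded_bilinear assms[unfolded has_wirtinger_def]]
  by (simp add: has_wirtinger_def scaleC_add_right scaleC_add_left scaleC_scaleC scaleC_complex_def
      algebra_simps)

lemma has_wirtinger_mult:
  fixes f g :: "complex \<Rightarrow> complex"
  assumes "has_wirtinger f a b z" "has_wirtinger g c d z"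
  shows "has_wirtinger (\<lambda>w. f w * g w) (a * g z + f z * c) (b * g z + f z * d) z"
  using has_wirtinger_scaleC[OF assms] by (simp add: scaleC_complex_def)

lemma has_wirtinger_inverse:
  fixes f :: "complex \<Rightarrow> complex"
  assumes "has_wirtinger f a b z" "f z \<noteq> 0"
  shows "has_wirtinger (\<lambda>w. inverse (f w))
    (- a * (inverse (f z) * inverse (f z))) (- b * (inverse (f z) * inverse (f z))) z"
proof -
  have "(\<lambda>w. - (y * (w *\<^sub>C a + cnj w *\<^sub>C b) * y)) = (\<lambda>w. w *\<^sub>C (- a * (y * y)) + cnj w *\<^sub>C (- b * (y * y)))"
    for y
    by (rule ext, unfold scaleC_complex_def) algebra
  then show ?thesis
    using Deriv.has_derivative_inverse[OF assms(2) assms(1)[unfolded has_wirtinger_def]]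
    by (simp only: has_wirtinger_def)
qed

lemma has_wirtinger_component:
  assumes "has_wirtinger f a b z"
  shows "has_wirtinger (\<lambda>w. f w $ i) (a $ i) (b $ i) z"
  using bounded_linear.has_derivative[OF bounded_linear_vec_nth assms[unfolded has_wirtinger_def]]
  by (simp add: has_wirtinger_def scaleC_vec_def)

text \<open>A vector is the sum of its components placed on the axes, and each placement
  \<open>axis i\<close> is bounded linear.\<close>

lemma has_wirtinger_vec:
  fixes f :: "complex \<Rightarrow> 'a::complex_normed_vector ^ 'b::finite"
  assumes "\<And>i. has_wirtinger (\<lambda>w. f w $ i) (a $ i) (b $ i) z"
  shows "has_wirtinger f a b z"
proof -
  have lin: "bounded_linear (\<lambda>x :: 'a. axis i x :: 'a ^ 'b)" for i
  proof (rule bounded_linear_intro[of _ 1])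
    show "norm (axis i x :: 'a ^ 'b) \<le> norm x * 1" for x :: 'a
      using L2_set_le_sum[of UNIV "\<lambda>j. norm ((axis i x :: 'a ^ 'b) $ j)"]
      by (simp add: norm_vec_def axis_def if_distrib cong: if_cong)
  qed (auto simp: axis_def vec_eq_iff)
  have ax: "(\<Sum>i\<in>UNIV. axis i (v $ i)) = v" for v :: "'a ^ 'b"
    by (simp add: vec_eq_iff axis_def if_distrib cong: if_cong)
  have "((\<lambda>w. \<Sum>i\<in>UNIV. axis i (f w $ i)) has_derivative
      (\<lambda>w. \<Sum>i\<in>UNIV. axis i (w *\<^sub>C a $ i + cnj w *\<^sub>C b $ i))) (at z)"
    by (intro has_derivative_sum bounded_linear.has_derivative[OF lin]
        assms[unfolded has_wirtinger_def])
  moreover have "(\<Sum>i\<in>UNIV. axis i (w *\<^sub>C a $ i + cnj w *\<^sub>C b $ i)) = w *\<^sub>C a + cnj w *\<^sub>C b" for w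
    by (subst ax[symmetric]) (simp add: scaleC_vec_def)
  ultimately show ?thesis
    by (simp add: ax has_wirtinger_def)
qed

text \<open>Since \<open>v\<close> enters conjugated, its holomorphic variation contributes only to
  \<partial>bar, while that of \<open>u\<close> contributes only to \<partial>. The same split holds
  for \<open>rank_one\<close>.\<close>

lemma has_wirtinger_cinner:
  assumes "has_wirtinger u u' 0 z" "has_wirtinger v v' 0 z"
  shows "has_wirtinger (\<lambda>w. cinner (u w) (v w)) (cinner u' (v z)) (cinner (u z) v') z"
  using bounded_bilinear.FDERIV[OF cinner_bounded_bilinear assms[unfolded has_wirtinger_def]]
  by (simp add: has_wirtinger_def cinner_scaleC_left cinner_scaleC_right scaleC_complex_def
      add.commute)

lemma has_wirtinger_rank_one:
  assumes "has_wirtinger u u' 0 z" "has_wirtinger v v' 0 z"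
  shows "has_wirtinger (\<lambda>w. rank_one (u w) (v w)) (rank_one u' (v z)) (rank_one (u z) v') z"
  using bounded_bilinear.FDERIV[OF rank_one_bounded_bilinear assms[unfolded has_wirtinger_def]]
  by (simp add: has_wirtinger_def rank_one_scaleC_left rank_one_scaleC_right add.commute)

lemma vholomorphic_on_open:
  assumes "open S"
  shows "vholomorphic_on f S \<longleftrightarrow> (\<forall>z\<in>S. has_wirtinger f (\<partial> f z) 0 z)"
proof -
  have "(\<exists>D. has_wirtinger f D 0 z) \<longleftrightarrow> has_wirtinger f (\<partial> f z) 0 z" for z
  proof
    assume "\<exists>D. has_wirtinger f D 0 z"
    then obtain D where D: "has_wirtinger f D 0 z" ..
    then show "has_wirtinger f (\<partial> f z) 0 z"
      by (simp only: has_wirtinger_imp(1)[OF D])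
  qed blast
  moreover have "(f has_derivative (\<lambda>w. w *\<^sub>C D)) (at z within S) \<longleftrightarrow> has_wirtinger f D 0 z"
    if "z \<in> S" for z D
    by (simp add: has_wirtinger_def at_within_open[OF that assms])
  ultimately show ?thesis by (simp add: vholomorphic_on_def)
qed

section \<open>Derivatives of holomorphic vectors\<close>

text \<open>First-order Taylor expansion of g' about z. The remainder is controlled by the third
  derivative of g, and Cauchy's inequality on discs of radius r/2 bounds that by 3! B / (r/2)^3 = 48
  B / r^3.\<close>

lemma holomorphic_derivative_quotient_bound:
  assumes g: "g holomorphic_on ball z (2 * r)" and r: "0 < r"
    and B: "\<And>w. w \<in> ball z (2 * r) \<Longrightarrow> cmod (g w) \<le> B"
    and w: "w \<in> ball z r" "w \<noteq> z"
  shows "cmod ((deriv g w - deriv g z) / (w - z) - (deriv ^^ 2) g z) \<le> (48 * B / r ^ 3) * cmod (w - z)"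
proof -
  let ?f = "\<lambda>i. (deriv ^^ Suc i) g"
  have "cmod (?f 0 w - (\<Sum>i\<le>1. ?f i z * (w - z) ^ i / fact i))
      \<le> (48 * B / r ^ 3) * cmod (w - z) ^ Suc 1 / fact 1"
  proof (rule complex_Taylor)
    show "convex (ball z r)" by simp
    show "(?f i has_field_derivative ?f (Suc i) x) (at x within ball z r)"
      if "x \<in> ball z r" for i x
    proof -
      have "x \<in> ball z (2 * r)" using that r by auto
      then have "(?f i has_field_derivative deriv (?f i) x) (at x)"
        by (intro holomorphic_derivI[OF holomorphic_higher_deriv[OF g]]) auto
      then show ?thesis by (auto intro: has_field_derivative_at_within)
    qed
    show "cmod (?f (Suc 1) x) \<le> 48 * B / r ^ 3" if x: "x \<in> ball z r" for x
    proof -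
      have sub: "cball x (r / 2) \<subseteq> ball z (2 * r)"
      proof
        fix y assume "y \<in> cball x (r / 2)"
        then have "dist z y \<le> dist z x + r / 2"
          using dist_triangle[of z y x] by simp
        then show "y \<in> ball z (2 * r)" using x r by simp
      qed
      have "cmod ((deriv ^^ 3) g x) \<le> fact 3 * B / (r / 2) ^ 3"
      proof (rule Cauchy_inequality)
        show "g holomorphic_on ball x (r / 2)"
          using g sub ball_subset_cball by (meson holomorphic_on_subset order_trans)
        show "continuous_on (cball x (r / 2)) g"
          using g sub by (meson holomorphic_on_imp_continuous_on holomorphic_on_subset)
        show "cmod (g y) \<le> B" if "cmod (x - y) = r / 2" for y
          using B sub that by (auto simp: dist_norm subset_iff)
      qed (use r in simp)
      then show ?thesis by (simp add: numeral_3_eq_3 fact_numeral power_divide)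
    qed
  qed (use w r in auto)
  then have "cmod (deriv g w - deriv g z - (deriv ^^ 2) g z * (w - z))
      \<le> (48 * B / r ^ 3) * cmod (w - z) * cmod (w - z)"
    by (simp add: numeral_2_eq_2 algebra_simps)
  moreover have "(deriv g w - deriv g z) / (w - z) - (deriv ^^ 2) g z
      = (deriv g w - deriv g z - (deriv ^^ 2) g z * (w - z)) / (w - z)"
    using w by (simp add: diff_divide_distrib)
  ultimately show ?thesis
    using w by (simp add: norm_divide divide_le_eq)
qed

text \<open>The Cauchy estimates for the scalar functions \<open>\<langle>f, y\<rangle>\<close> are uniform in unit vectors \<open>y\<close>, so the
  difference quotients of the derivative of \<open>f\<close> satisfy a Cauchy condition in norm.\<close>

lemma vholomorphic_on_wirt_d:
  fixes f :: "complex \<Rightarrow> 'a::complex_hilbert_space"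
  assumes S: "open S" and f: "vholomorphic_on f S"
  shows "vholomorphic_on (\<partial> f) S"
  unfolding vholomorphic_on_def
proof
  fix z
  assume z: "z \<in> S"
  have D: "has_wirtinger f (\<partial> f w) 0 w" if "w \<in> S" for w
    using f that by (simp add: vholomorphic_on_open[OF S])
  obtain r0 where r0: "r0 > 0" "cball z r0 \<subseteq> S"
    using S z by (meson open_contains_cball)
  define r where "r = r0 / 2"
  have r: "0 < r" "cball z (2 * r) \<subseteq> S" "ball z (2 * r) \<subseteq> S"
    using r0 by (auto simp: r_def)
  have "continuous_on S f"
    by (rule continuous_at_imp_continuous_on)
      (metis D has_derivative_continuous has_wirtinger_def)
  then have "compact (f ` cball z (2 * r))"
    using r by (intro compact_continuous_image) (auto intro: continuous_on_subset)
  then obtain M where M: "norm (f w) \<le> M" if "w \<in> cball z (2 * r)" for w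
    by (meson compact_imp_bounded bounded_iff imageI)
  define C where "C = 48 * M / r ^ 3"
  define q where "q w = (1 / (w - z)) *\<^sub>C (\<partial> f w - \<partial> f z)" for w
  have scalar: "\<exists>d. \<forall>w\<in>ball z r - {z}. cmod (cinner (q w) y - d) \<le> C * norm y * cmod (w - z)" for y
  proof -
    define g where "g w = cinner (f w) y" for w
    have g': "(g has_field_derivative cinner (\<partial> f w) y) (at w)" if "w \<in> S" for w
      using has_wirtinger_cinner[OF D[OF that], of "\<lambda>_. y" 0] has_wirtinger_const[of y]
      by (simp add: has_wirtinger_def has_field_derivative_def g_def[abs_def] scaleC_complex_def
          mult_commute_abs)
    have deriv: "deriv g w = cinner (\<partial> f w) y" if "w \<in> S" for w
      using g'[OF that] by (rule DERIV_imp_deriv)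
    have "cmod (cinner (q w) y - (deriv ^^ 2) g z) \<le> C * norm y * cmod (w - z)"
      if w: "w \<in> ball z r - {z}" for w
    proof -
      have "cmod ((deriv g w - deriv g z) / (w - z) - (deriv ^^ 2) g z)
          \<le> (48 * (M * norm y) / r ^ 3) * cmod (w - z)"
      proof (rule holomorphic_derivative_quotient_bound)
        show "g holomorphic_on ball z (2 * r)"
          using g' r by (auto simp: holomorphic_on_open)
        show "cmod (g x) \<le> M * norm y" if "x \<in> ball z (2 * r)" for x
          unfolding g_def using that M
          by (intro order_trans[OF cmod_cinner_le] mult_right_mono) auto
      qed (use w r in auto)
      moreover have "w \<in> S" using w r by (auto simp: subset_iff)
      ultimately show ?thesis
        using z by (simp add: deriv q_def cinner_scaleC_left cinner_diff_left C_def ac_simps)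
    qed
    then show ?thesis by blast
  qed
  have cauchy: "norm (q w - q v) \<le> C * (cmod (w - z) + cmod (v - z))"
    if w: "w \<in> ball z r - {z}" and v: "v \<in> ball z r - {z}" for w v
  proof (cases "q w = q v")
    case True
    have "M \<ge> 0"
      using M[of z] r by (simp add: order_trans[OF norm_ge_zero])
    then show ?thesis using True r by (simp add: C_def)
  next
    case False
    \<comment> \<open>Pairing with the difference \<open>y\<close> itself turns the scalar estimates
      into a bound on |y|^2 with a factor |y| on the right, which cancels.\<close>
    define y where "y = q w - q v"
    obtain d where d: "\<forall>w\<in>ball z r - {z}. cmod (cinner (q w) y - d) \<le> C * norm y * cmod (w - z)"
      using scalar by blast
    have "norm y * norm y = cmod (cinner y y)"
      by (simp add: cinner_self norm_power power2_eq_square[symmetric])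
    also have "\<dots> = cmod ((cinner (q w) y - d) - (cinner (q v) y - d))"
      by (subst y_def) (simp add: cinner_diff_left)
    also have "\<dots> \<le> cmod (cinner (q w) y - d) + cmod (cinner (q v) y - d)"
      by (rule norm_triangle_ineq4)
    also have "\<dots> \<le> C * norm y * cmod (w - z) + C * norm y * cmod (v - z)"
      using d w v by (intro add_mono) blast+
    also have "\<dots> = C * (cmod (w - z) + cmod (v - z)) * norm y"
      by (simp only: distrib_left distrib_right mult.commute mult.left_commute)
    finally show ?thesis
      using False by (simp add: y_def)
  qed
  \<comment> \<open>An arbitrary sequence tending to z inside the punctured ball;
    \<open>n + 2\<close> keeps the distance strictly below r already at n = 0.\<close>
  define p where "p n = z + of_real (r / real (n + 2))" for n
  have p_dist: "cmod (p n - z) = r / real (n + 2)" for n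
    using r by (simp only: p_def add_diff_cancel_left' norm_of_real) simp
  have p: "p n \<in> ball z r - {z}" for n
  proof -
    have "0 < cmod (p n - z)" "cmod (p n - z) < r"
      using r by (simp_all add: p_dist divide_less_eq)
    then show ?thesis by (auto simp: dist_norm norm_minus_commute)
  qed
  have p_lim: "(\<lambda>n. cmod (p n - z)) \<longlonglongrightarrow> 0"
    unfolding p_dist by (rule LIMSEQ_ignore_initial_segment[OF lim_const_over_n])
  have "Cauchy (\<lambda>n. q (p n))"
  proof (rule metric_CauchyI)
    fix e :: real
    assume e: "e > 0"
    have "(\<lambda>n. C * cmod (p n - z)) \<longlonglongrightarrow> C * 0"
      by (intro tendsto_intros p_lim)
    then have "\<forall>\<^sub>F n in sequentially. C * cmod (p n - z) < e / 2"
      using e by (intro order_tendstoD(2)) auto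
    then obtain N where N: "\<And>n. n \<ge> N \<Longrightarrow> C * cmod (p n - z) < e / 2"
      by (auto simp: eventually_sequentially)
    have "dist (q (p m)) (q (p n)) < e" if "m \<ge> N" "n \<ge> N" for m n
      using cauchy[OF p p, of m n] N[OF that(1)] N[OF that(2)] by (simp add: dist_norm distrib_left)
    then show "\<exists>N. \<forall>m\<ge>N. \<forall>n\<ge>N. dist (q (p m)) (q (p n)) < e" by blast
  qed
  then obtain L where L: "(\<lambda>n. q (p n)) \<longlonglongrightarrow> L"
    by (meson Cauchy_convergent_iff convergent_def)
  \<comment> \<open>Letting the second point of \<open>cauchy\<close> run through \<open>p n\<close>
    towards z removes its term from the bound, so \<open>L\<close> is the limit of \<open>q\<close>
    along every approach, not only along \<open>p\<close>.\<close>
  have q_bound: "norm (q w - L) \<le> C * cmod (w - z)" if w: "w \<in> ball z r - {z}" for w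
  proof (rule LIMSEQ_le)
    show "(\<lambda>n. norm (q w - q (p n))) \<longlonglongrightarrow> norm (q w - L)"
      by (intro tendsto_intros L)
    have "(\<lambda>n. C * (cmod (w - z) + cmod (p n - z))) \<longlonglongrightarrow> C * (cmod (w - z) + 0)"
      by (intro tendsto_intros p_lim)
    then show "(\<lambda>n. C * (cmod (w - z) + cmod (p n - z))) \<longlonglongrightarrow> C * cmod (w - z)"
      by simp
    show "\<exists>N. \<forall>n\<ge>N. norm (q w - q (p n)) \<le> C * (cmod (w - z) + cmod (p n - z))"
      using cauchy[OF w p] by blast
  qed
  have "(\<partial> f has_derivative (\<lambda>w. w *\<^sub>C L)) (at z within S)"
  proof (rule has_derivativeI_sandwich[OF r(1)])
    show "bounded_linear (\<lambda>w. w *\<^sub>C L)"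
      by (rule bounded_bilinear.bounded_linear_left[OF scaleC_bounded_bilinear])
    show "norm (\<partial> f w - \<partial> f z - (w - z) *\<^sub>C L) / norm (w - z) \<le> C * cmod (w - z)"
      if "w \<noteq> z" "dist w z < r" for w
    proof -
      have "\<partial> f w - \<partial> f z - (w - z) *\<^sub>C L = (w - z) *\<^sub>C (q w - L)"
        using that by (simp add: q_def cvec.scale_right_diff_distrib scaleC_scaleC scaleC_one)
      then show ?thesis
        using that q_bound[of w] by (simp add: norm_scaleC dist_commute)
    qed
    have "((\<lambda>w. C * cmod (w - z)) \<longlongrightarrow> C * cmod (z - z)) (at z within S)"
      by (intro tendsto_intros)
    then show "((\<lambda>w. C * cmod (w - z)) \<longlongrightarrow> 0) (at z within S)" by simp
  qed
  then show "\<exists>D. (\<partial> f has_derivative (\<lambda>w. w *\<^sub>C D)) (at z within S)" by blast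
qed

section \<open>Matrix-valued functions and the trace of covariant derivatives\<close>

lemma matrix_inv_mult:
  assumes "invertible A"
  shows "A ** matrix_inv A = mat 1" "matrix_inv A ** A = mat 1"
  using someI_ex[OF assms[unfolded invertible_def]] by (simp_all add: matrix_inv_def)

definition conj_transpose :: "complex ^ 'n ^ 'm \<Rightarrow> complex ^ 'm ^ 'n" where
  "conj_transpose A = (\<chi> i j. cnj (A $ j $ i))"

lemma conj_transpose_mult: "conj_transpose (A ** B) = conj_transpose B ** conj_transpose A"
  by (simp add: conj_transpose_def matrix_matrix_mult_def vec_eq_iff mult.commute)

lemma matrix_mult_uminus:
  fixes A :: "'r::ring_1 ^ 'k::finite ^ 'm::finite" and B :: "'r ^ 'n::finite ^ 'k"
  shows "(- A) ** B = - (A ** B)" "A ** (- B) = - (A ** B)"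
  by (simp_all add: matrix_matrix_mult_def vec_eq_iff sum_negf)

lemma matrix_mult_distrib:
  fixes A A' :: "'r::ring_1 ^ 'k::finite ^ 'm::finite" and B B' :: "'r ^ 'n::finite ^ 'k"
  shows "(A + A') ** B = A ** B + A' ** B" "(A - A') ** B = A ** B - A' ** B"
    "A ** (B - B') = A ** B - A ** B'"
  by (simp_all add: matrix_matrix_mult_def vec_eq_iff algebra_simps sum.distrib sum_subtractf)

lemma has_wirtinger_matrix_mult:
  fixes A :: "complex \<Rightarrow> complex ^ 'k::finite ^ 'm::finite" and B :: "complex \<Rightarrow> complex ^ 'n::finite ^ 'k"
  assumes "has_wirtinger A a a' z" "has_wirtinger B b b' z"
  shows "has_wirtinger (\<lambda>w. A w ** B w) (a ** B z + A z ** b) (a' ** B z + A z ** b') z"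
proof (intro has_wirtinger_vec)
  fix i j
  have "has_wirtinger (\<lambda>w. \<Sum>k\<in>UNIV. A w $ i $ k * B w $ k $ j)
      (\<Sum>k\<in>UNIV. a $ i $ k * B z $ k $ j + A z $ i $ k * b $ k $ j)
      (\<Sum>k\<in>UNIV. a' $ i $ k * B z $ k $ j + A z $ i $ k * b' $ k $ j) z"
    by (intro has_wirtinger_sum has_wirtinger_mult has_wirtinger_component assms)
  then show "has_wirtinger (\<lambda>w. (A w ** B w) $ i $ j)
      ((a ** B z + A z ** b) $ i $ j) ((a' ** B z + A z ** b') $ i $ j) z"
    by (simp add: matrix_matrix_mult_def sum.distrib)
qed

text \<open>Differentiate \<open>M ** matrix_inv M = mat 1\<close> and solve for the derivative of
  the inverse. The product rule requires the inverse to be differentiable; Cramer's rule provides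
  this in \<open>alg_matrix_inv\<close>.\<close>

lemma has_wirtinger_matrix_inv:
  fixes M :: "complex \<Rightarrow> complex ^ 'n::finite ^ 'n"
  assumes S: "open S" "z \<in> S" and inv: "\<And>w. w \<in> S \<Longrightarrow> invertible (M w)"
    and M: "has_wirtinger M a b z" and I: "(\<lambda>w. matrix_inv (M w)) differentiable (at z)"
  shows "has_wirtinger (\<lambda>w. matrix_inv (M w)) (- (matrix_inv (M z) ** a ** matrix_inv (M z)))
    (- (matrix_inv (M z) ** b ** matrix_inv (M z))) z"
proof -
  let ?I = "\<lambda>w. matrix_inv (M w)"
  have I': "has_wirtinger ?I (\<partial> ?I z) (\<partial>bar ?I z) z"
    using I by (rule has_wirtinger_differentiable)
  have "has_wirtinger (\<lambda>w. M w ** ?I w) 0 0 z"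
    by (subst has_wirtinger_cong[OF S, of _ "\<lambda>_. mat 1"])
      (simp_all add: matrix_inv_mult inv has_wirtinger_const)
  then have "a ** ?I z + M z ** \<partial> ?I z = 0" "b ** ?I z + M z ** \<partial>bar ?I z = 0"
    using has_wirtinger_imp[OF has_wirtinger_matrix_mult[OF M I']] has_wirtinger_imp by metis+
  moreover have "x = - (?I z ** y ** ?I z)" if "y ** ?I z + M z ** x = 0" for x y
  proof -
    have "?I z ** (M z ** x) = x"
      by (simp add: matrix_mul_assoc matrix_inv_mult inv S)
    moreover have "M z ** x = - (y ** ?I z)"
      using that by (simp add: add_eq_0_iff)
    moreover have "?I z ** - (y ** ?I z) = - (?I z ** (y ** ?I z))"
      by (simp add: matrix_matrix_mult_def vec_eq_iff sum_negf)
    ultimately show ?thesis by (simp add: matrix_mul_assoc)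
  qed
  ultimately show ?thesis using I' by metis
qed

lemma has_wirtinger_trace:
  fixes M :: "complex \<Rightarrow> complex ^ 'n::finite ^ 'n"
  assumes "has_wirtinger M a b z"
  shows "has_wirtinger (\<lambda>w. trace (M w)) (trace a) (trace b) z"
  unfolding trace_def by (intro has_wirtinger_sum has_wirtinger_component assms)

text \<open>A concrete algebra of smooth functions on \<open>S\<close> replaces the general theory of smooth functions:
  it is generated by a set closed under both Wirtinger derivatives, and the mixed derivatives of its
  elements commute because they do so for the generators.\<close>

inductive wirtinger_algebra ::
    "complex set \<Rightarrow> (complex \<Rightarrow> complex) set \<Rightarrow> (complex \<Rightarrow> complex) \<Rightarrow> bool"
  for S G where
    generator: "g \<in> G \<Longrightarrow> wirtinger_algebra S G g"
  | const: "wirtinger_algebra S G (\<lambda>_. c)"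
  | add: "wirtinger_algebra S G f \<Longrightarrow> wirtinger_algebra S G g \<Longrightarrow> wirtinger_algebra S G (\<lambda>z. f z + g z)"
  | mult: "wirtinger_algebra S G f \<Longrightarrow> wirtinger_algebra S G g \<Longrightarrow> wirtinger_algebra S G (\<lambda>z. f z * g z)"
  | inverse: "wirtinger_algebra S G f \<Longrightarrow> (\<And>z. z \<in> S \<Longrightarrow> f z \<noteq> 0) \<Longrightarrow>
      wirtinger_algebra S G (\<lambda>z. inverse (f z))"
  | cong: "wirtinger_algebra S G f \<Longrightarrow> (\<And>z. z \<in> S \<Longrightarrow> g z = f z) \<Longrightarrow> wirtinger_algebra S G g"

text \<open>The shared value \<open>c\<close> is at once the \<partial>bar-derivative of
  \<open>a\<close> and the \<partial>-derivative of \<open>b\<close>: this encodes the equality of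
  the mixed derivatives of a generator.\<close>

locale wirtinger_closed =
  fixes S :: "complex set" and G :: "(complex \<Rightarrow> complex) set"
  assumes open_S: "open S"
    and generator_derivatives: "g \<in> G \<Longrightarrow> \<exists>a\<in>G. \<exists>b\<in>G. \<forall>z\<in>S. \<exists>p c q.
      has_wirtinger g (a z) (b z) z \<and> has_wirtinger a p c z \<and> has_wirtinger b c q z"
begin

abbreviation "alg \<equiv> wirtinger_algebra S G"

lemma alg_uminus: "alg f \<Longrightarrow> alg (\<lambda>z. - f z)"
  using wirtinger_algebra.mult[OF wirtinger_algebra.const[of S G "-1"], of f] by simp

lemma alg_sum: "(\<And>i. i \<in> I \<Longrightarrow> alg (f i)) \<Longrightarrow> alg (\<lambda>z. \<Sum>i\<in>I. f i z)"
  by (induction I rule: infinite_finite_induct)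
    (simp_all add: wirtinger_algebra.const wirtinger_algebra.add)

lemma alg_prod: "(\<And>i. i \<in> I \<Longrightarrow> alg (f i)) \<Longrightarrow> alg (\<lambda>z. \<Prod>i\<in>I. f i z)"
  by (induction I rule: infinite_finite_induct)
    (simp_all add: wirtinger_algebra.const wirtinger_algebra.mult)

text \<open>Induction over the generation of the algebra. Keeping the common mixed derivative
  \<open>c\<close> in the claim makes each rule of calculus transport the commutation from the
  generators.\<close>

lemma alg_derivatives_ex:
  "alg f \<Longrightarrow> \<exists>a b. alg a \<and> alg b \<and> (\<forall>z\<in>S. \<exists>p c q.
      has_wirtinger f (a z) (b z) z \<and> has_wirtinger a p c z \<and> has_wirtinger b c q z)"
proof (induction rule: wirtinger_algebra.induct)
  case (generator g)
  then show ?case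
    using generator_derivatives by (meson wirtinger_algebra.generator)
next
  case (const c)
  show ?case
    by (rule exI[of _ "\<lambda>_. 0"], rule exI[of _ "\<lambda>_. 0"])
      (blast intro: has_wirtinger_const wirtinger_algebra.const)
next
  case (add f g)
  then obtain a b a' b' where alg: "alg a" "alg b" "alg a'" "alg b'"
    and f: "\<And>z. z \<in> S \<Longrightarrow> \<exists>p c q. has_wirtinger f (a z) (b z) z \<and> has_wirtinger a p c z \<and> has_wirtinger b c q z"
    and g: "\<And>z. z \<in> S \<Longrightarrow> \<exists>p c q. has_wirtinger g (a' z) (b' z) z \<and> has_wirtinger a' p c z \<and> has_wirtinger b' c q z"
    by blast
  have "\<forall>z\<in>S. \<exists>p c q. has_wirtinger (\<lambda>z. f z + g z) (a z + a' z) (b z + b' z) z \<and>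
      has_wirtinger (\<lambda>z. a z + a' z) p c z \<and> has_wirtinger (\<lambda>z. b z + b' z) c q z"
    using f g by (blast intro: has_wirtinger_add)
  moreover have "alg (\<lambda>z. a z + a' z)" "alg (\<lambda>z. b z + b' z)"
    using alg by (auto intro: wirtinger_algebra.add)
  ultimately show ?case by blast
next
  case (mult f g)
  then obtain a b a' b' where alg: "alg a" "alg b" "alg a'" "alg b'"
    and f: "\<And>z. z \<in> S \<Longrightarrow> \<exists>p c q. has_wirtinger f (a z) (b z) z \<and> has_wirtinger a p c z \<and> has_wirtinger b c q z"
    and g: "\<And>z. z \<in> S \<Longrightarrow> \<exists>p c q. has_wirtinger g (a' z) (b' z) z \<and> has_wirtinger a' p c z \<and> has_wirtinger b' c q z"
    by blast
  let ?a = "\<lambda>z. a z * g z + f z * a' z" and ?b = "\<lambda>z. b z * g z + f z * b' z"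
  have "\<exists>p c q. has_wirtinger (\<lambda>z. f z * g z) (?a z) (?b z) z \<and>
      has_wirtinger ?a p c z \<and> has_wirtinger ?b c q z" if z: "z \<in> S" for z
  proof -
    obtain p c q p' c' q' where
      f1: "has_wirtinger f (a z) (b z) z" "has_wirtinger a p c z" "has_wirtinger b c q z" and
      g1: "has_wirtinger g (a' z) (b' z) z" "has_wirtinger a' p' c' z" "has_wirtinger b' c' q' z"
      using f[OF z] g[OF z] by blast
    have "has_wirtinger ?a (p * g z + a z * a' z + (a z * a' z + f z * p'))
        (c * g z + a z * b' z + (b z * a' z + f z * c')) z"
      by (intro has_wirtinger_add has_wirtinger_mult f1 g1)
    moreover have "has_wirtinger ?b (c * g z + b z * a' z + (a z * b' z + f z * c'))
        (q * g z + b z * b' z + (b z * b' z + f z * q')) z"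
      by (intro has_wirtinger_add has_wirtinger_mult f1 g1)
    \<comment> \<open>The two mixed derivatives of the product consist of the same four summands in
      different order.\<close>
    moreover have "c * g z + b z * a' z + (a z * b' z + f z * c')
        = c * g z + a z * b' z + (b z * a' z + f z * c')"
      by simp
    ultimately show ?thesis
      using has_wirtinger_mult[OF f1(1) g1(1)] by auto
  qed
  moreover have "alg ?a" "alg ?b"
    by (intro wirtinger_algebra.add wirtinger_algebra.mult alg mult.hyps)+
  ultimately show ?case by blast
next
  case (inverse f)
  then obtain a b where alg: "alg a" "alg b"
    and f: "\<And>z. z \<in> S \<Longrightarrow> \<exists>p c q. has_wirtinger f (a z) (b z) z \<and> has_wirtinger a p c z \<and> has_wirtinger b c q z"
    by blast
  let ?i = "\<lambda>z. inverse (f z)"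
  let ?a = "\<lambda>z. - a z * (?i z * ?i z)" and ?b = "\<lambda>z. - b z * (?i z * ?i z)"
  have "\<exists>p c q. has_wirtinger ?i (?a z) (?b z) z \<and> has_wirtinger ?a p c z \<and> has_wirtinger ?b c q z"
    if z: "z \<in> S" for z
  proof -
    obtain p c q where
      f1: "has_wirtinger f (a z) (b z) z" "has_wirtinger a p c z" "has_wirtinger b c q z"
      using f[OF z] by blast
    have i1: "has_wirtinger ?i (?a z) (?b z) z"
      by (rule has_wirtinger_inverse[OF f1(1) inverse.hyps(2)[OF z]])
    note rules = has_wirtinger_mult[OF _ has_wirtinger_mult[OF i1 i1]]
    \<comment> \<open>The first coefficient is written in the form that the product rule gives for
      \<partial>bar of \<open>?a\<close>; the two forms agree because
      \<open>b z * ?a z = a z * ?b z\<close>.\<close>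
    have "has_wirtinger ?b (- c * (?i z * ?i z) + - a z * (?b z * ?i z + ?i z * ?b z))
        (- q * (?i z * ?i z) + - b z * (?b z * ?i z + ?i z * ?b z)) z"
      using rules[OF has_wirtinger_uminus[OF f1(3)]] by (simp add: mult_ac)
    then show ?thesis
      using i1 rules[OF has_wirtinger_uminus[OF f1(2)]] by blast
  qed
  moreover have "alg ?a" "alg ?b"
    by (intro wirtinger_algebra.mult wirtinger_algebra.inverse alg_uminus alg inverse.hyps;
        assumption)+
  ultimately show ?case by blast
next
  case (cong f g)
  then show ?case
    by (simp add: has_wirtinger_cong[OF open_S _ cong.hyps(2)])
qed

lemma
  assumes "alg f"
  shows alg_wirt_d: "alg (\<partial> f)" and alg_wirt_dbar: "alg (\<partial>bar f)"
    and alg_has_wirtinger: "\<And>z. z \<in> S \<Longrightarrow> has_wirtinger f (\<partial> f z) (\<partial>bar f z) z"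
    and alg_wirt_commute: "\<And>z. z \<in> S \<Longrightarrow> \<partial>bar (\<partial> f) z = \<partial> (\<partial>bar f) z"
proof -
  obtain a b where ab: "alg a" "alg b" and f: "\<And>z. z \<in> S \<Longrightarrow> \<exists>p c q.
      has_wirtinger f (a z) (b z) z \<and> has_wirtinger a p c z \<and> has_wirtinger b c q z"
    using alg_derivatives_ex[OF assms] by blast
  have eq: "\<partial> f z = a z" "\<partial>bar f z = b z" if "z \<in> S" for z
    using f[OF that] has_wirtinger_imp by blast+
  \<comment> \<open>The derivatives are known to agree with the witnesses on \<open>S\<close> only;
    the \<open>cong\<close> rule of the algebra bridges this.\<close>
  show "alg (\<partial> f)" "alg (\<partial>bar f)"
    using ab eq by (auto intro: wirtinger_algebra.cong)
  fix z
  assume z: "z \<in> S"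
  show "has_wirtinger f (\<partial> f z) (\<partial>bar f z) z"
    using f[OF z] by (auto simp: eq[OF z])
  have "\<partial>bar a z = \<partial> b z"
    using f[OF z] has_wirtinger_imp by metis
  then show "\<partial>bar (\<partial> f) z = \<partial> (\<partial>bar f) z"
    using wirtinger_cong[OF open_S z] eq by metis
qed

lemma alg_funpow_wirt_d: "alg f \<Longrightarrow> alg ((\<partial> ^^ i) f)"
  by (induction i) (simp_all add: alg_wirt_d)

lemma alg_funpow_wirt_dbar: "alg f \<Longrightarrow> alg ((\<partial>bar ^^ i) f)"
  by (induction i) (simp_all add: alg_wirt_dbar)

lemma wirt_dbar_funpow_wirt_d:
  assumes "alg f" "z \<in> S"
  shows "\<partial>bar ((\<partial> ^^ i) f) z = (\<partial> ^^ i) (\<partial>bar f) z"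
  using assms(2)
proof (induction i arbitrary: z)
  case (Suc i)
  have "\<partial>bar (\<partial> ((\<partial> ^^ i) f)) z = \<partial> (\<partial>bar ((\<partial> ^^ i) f)) z"
    by (rule alg_wirt_commute[OF alg_funpow_wirt_d[OF assms(1)] Suc.prems])
  also have "\<dots> = \<partial> ((\<partial> ^^ i) (\<partial>bar f)) z"
    by (rule wirtinger_cong(1)[OF open_S Suc.prems Suc.IH])
  finally show ?case by simp
qed simp

section \<open>Matrices with entries in the algebra\<close>

definition alg_matrix :: "(complex \<Rightarrow> complex ^ 'n ^ 'm) \<Rightarrow> bool" where
  "alg_matrix M \<longleftrightarrow> (\<forall>i j. alg (\<lambda>z. M z $ i $ j))"

lemma alg_matrix_has_wirtinger:
  fixes M :: "complex \<Rightarrow> complex ^ 'n::finite ^ 'm::finite"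
  assumes "alg_matrix M" "z \<in> S"
  shows "has_wirtinger M (\<partial> M z) (\<partial>bar M z) z"
proof -
  let ?e = "\<lambda>i j w. M w $ i $ j"
  have "has_wirtinger M (\<chi> i j. \<partial> (?e i j) z) (\<chi> i j. \<partial>bar (?e i j) z) z"
    using assms by (intro has_wirtinger_vec) (simp add: alg_matrix_def alg_has_wirtinger)
  then show ?thesis
    by (rule has_wirtinger_differentiable[OF has_wirtinger_imp_differentiable])
qed

lemma
  fixes M :: "complex \<Rightarrow> complex ^ 'n::finite ^ 'm::finite"
  assumes "alg_matrix M"
  shows alg_matrix_wirt_d: "alg_matrix (\<partial> M)" and alg_matrix_wirt_dbar: "alg_matrix (\<partial>bar M)"
proof -
  have "\<partial> M z $ i $ j = \<partial> (\<lambda>w. M w $ i $ j) z" "\<partial>bar M z $ i $ j = \<partial>bar (\<lambda>w. M w $ i $ j) z"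
    if "z \<in> S" for z i j
    using has_wirtinger_imp[OF has_wirtinger_component[OF has_wirtinger_component[OF
        alg_matrix_has_wirtinger[OF assms that], of i], of j]] by simp_all
  moreover have "alg (\<partial> (\<lambda>w. M w $ i $ j))" "alg (\<partial>bar (\<lambda>w. M w $ i $ j))" for i j
    using assms by (simp_all add: alg_matrix_def alg_wirt_d alg_wirt_dbar)
  ultimately show "alg_matrix (\<partial> M)" "alg_matrix (\<partial>bar M)"
    unfolding alg_matrix_def by (blast intro: wirtinger_algebra.cong)+
qed

lemma alg_matrix_add: "alg_matrix M \<Longrightarrow> alg_matrix N \<Longrightarrow> alg_matrix (\<lambda>z. M z + N z)"
  by (simp add: alg_matrix_def wirtinger_algebra.add)

lemma alg_matrix_uminus: "alg_matrix M \<Longrightarrow> alg_matrix (\<lambda>z. - M z)"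
  by (simp add: alg_matrix_def alg_uminus)

lemma alg_matrix_diff: "alg_matrix M \<Longrightarrow> alg_matrix N \<Longrightarrow> alg_matrix (\<lambda>z. M z - N z)"
  using alg_matrix_add[of M "\<lambda>z. - N z"] by (simp add: alg_matrix_uminus)

lemma alg_matrix_mult: "alg_matrix M \<Longrightarrow> alg_matrix N \<Longrightarrow> alg_matrix (\<lambda>z. M z ** N z)"
  by (simp add: alg_matrix_def matrix_matrix_mult_def alg_sum wirtinger_algebra.mult)

lemma alg_det:
  fixes M :: "complex \<Rightarrow> complex ^ 'n::finite ^ 'n"
  assumes "alg_matrix M"
  shows "alg (\<lambda>z. det (M z))"
  unfolding det_def using assms
  by (intro alg_sum wirtinger_algebra.mult alg_prod wirtinger_algebra.const)
    (simp add: alg_matrix_def)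

text \<open>By Cramer's rule every entry of the inverse is a quotient of two determinants, and
  determinants are polynomials in the entries.\<close>

lemma alg_matrix_inv:
  fixes M :: "complex \<Rightarrow> complex ^ 'n::finite ^ 'n"
  assumes M: "alg_matrix M" and inv: "\<And>z. z \<in> S \<Longrightarrow> invertible (M z)"
  shows "alg_matrix (\<lambda>z. matrix_inv (M z))"
  unfolding alg_matrix_def
proof (intro allI)
  fix i j
  \<comment> \<open>\<open>M\<close> with column \<open>i\<close> replaced by the
    \<open>j\<close>-th unit vector, the numerator of Cramer's rule for column \<open>j\<close> of
    the inverse.\<close>
  define N where "N z = (\<chi> k l. if l = i then axis j 1 $ k else M z $ k $ l)" for z
  have det: "det (M z) \<noteq> 0" if "z \<in> S" for z
    using inv[OF that] by (simp add: invertible_det_nz)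
  have "matrix_inv (M z) $ i $ j = det (N z) * inverse (det (M z))" if "z \<in> S" for z
  proof -
    have "M z ** matrix_inv (M z) = mat 1"
      using matrix_inv_mult(1)[OF inv[OF that]] .
    then have "M z *v (matrix_inv (M z) *v axis j 1) = axis j 1"
      by (simp add: matrix_vector_mul_assoc)
    then have "matrix_inv (M z) *v axis j 1
        = (\<chi> i. det (\<chi> k l. if l = i then axis j 1 $ k else M z $ k $ l) / det (M z))"
      by (simp only: cramer[OF det[OF that]])
    then have "(matrix_inv (M z) *v axis j 1) $ i = det (N z) / det (M z)"
      by (simp only: vec_lambda_beta N_def)
    then show ?thesis
      by (simp add: matrix_vector_mult_def axis_def divide_inverse if_distrib[of "\<lambda>t. _ * t"] cong: if_cong)
  qed
  moreover have "alg (\<lambda>z. det (N z) * inverse (det (M z)))"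
  proof (intro wirtinger_algebra.mult wirtinger_algebra.inverse alg_det M)
    show "alg_matrix N"
      unfolding alg_matrix_def
    proof (intro allI)
      show "alg (\<lambda>z. N z $ k $ l)" for k l
        using M by (cases "l = i") (simp_all add: N_def alg_matrix_def wirtinger_algebra.const)
    qed
  qed (use det in auto)
  ultimately show "alg (\<lambda>z. matrix_inv (M z) $ i $ j)"
    by (rule wirtinger_algebra.cong[rotated])
qed

lemma alg_matrix_connection:
  fixes h :: "complex \<Rightarrow> complex ^ 'n::finite ^ 'n"
  assumes "alg_matrix h" "\<And>z. z \<in> S \<Longrightarrow> invertible (h z)"
  shows "alg_matrix (connection h)"
  unfolding connection_def[abs_def]
  using assms by (intro alg_matrix_mult alg_matrix_inv alg_matrix_wirt_d)

lemma alg_matrix_cov_deriv: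
  fixes h :: "complex \<Rightarrow> complex ^ 'n::finite ^ 'n"
  assumes h: "alg_matrix h" "\<And>z. z \<in> S \<Longrightarrow> invertible (h z)" and "cov_deriv h i j K"
  shows "alg_matrix K"
  using assms(3)
proof induction
  case base
  then show ?case
    unfolding curvature_def[abs_def]
    by (intro alg_matrix_uminus alg_matrix_wirt_dbar alg_matrix_connection h)
next
  case dzbar
  then show ?case by (simp add: alg_matrix_wirt_dbar)
next
  case dz
  then show ?case
    unfolding commutator_def
    by (intro alg_matrix_add alg_matrix_diff alg_matrix_mult alg_matrix_wirt_d
        alg_matrix_connection h)
qed

text \<open>The right side is a normal form with every \<partial>bar applied first. It depends on
  \<open>i\<close> and \<open>j\<close> alone, so two covariant derivatives of the same type have
  equal traces on \<open>S\<close> whatever their orders of differentiation.\<close>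

lemma trace_cov_deriv:
  fixes h :: "complex \<Rightarrow> complex ^ 'n::finite ^ 'n"
  assumes h: "alg_matrix h" "\<And>z. z \<in> S \<Longrightarrow> invertible (h z)" and K: "cov_deriv h i j K"
  shows "z \<in> S \<Longrightarrow> trace (K z) = (\<partial> ^^ i) ((\<partial>bar ^^ j) (\<lambda>w. trace (curvature h w))) z"
  using K
proof (induction arbitrary: z)
  case base
  then show ?case by simp
next
  case (dzbar i j K)
  let ?\<kappa> = "(\<partial>bar ^^ j) (\<lambda>w. trace (curvature h w))"
  have "alg (\<lambda>w. trace (curvature h w))"
    using alg_matrix_cov_deriv[OF h cov_deriv.base] unfolding trace_def alg_matrix_def
    by (intro alg_sum) blast
  then have \<kappa>: "alg ?\<kappa>" by (rule alg_funpow_wirt_dbar)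
  have "trace (\<partial>bar K z) = \<partial>bar (\<lambda>w. trace (K w)) z"
    using has_wirtinger_imp(2)[OF has_wirtinger_trace[OF
        alg_matrix_has_wirtinger[OF alg_matrix_cov_deriv[OF h dzbar.hyps] dzbar.prems]]] by simp
  also have "\<dots> = \<partial>bar ((\<partial> ^^ i) ?\<kappa>) z"
    by (rule wirtinger_cong(2)[OF open_S dzbar.prems dzbar.IH])
  also have "\<dots> = (\<partial> ^^ i) (\<partial>bar ?\<kappa>) z"
    by (rule wirt_dbar_funpow_wirt_d[OF \<kappa> dzbar.prems])
  finally show ?case by simp
next
  case (dz i j K)
  have "trace (\<partial> K z + commutator (connection h z) (K z)) = trace (\<partial> K z)"
    by (simp add: trace_add commutator_def trace_sub trace_mul_sym[of "connection h z"])
  also have "\<dots> = \<partial> (\<lambda>w. trace (K w)) z"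
    using has_wirtinger_imp(1)[OF has_wirtinger_trace[OF
        alg_matrix_has_wirtinger[OF alg_matrix_cov_deriv[OF h dz.hyps] dz.prems]]] by simp
  also have "\<dots> = \<partial> ((\<partial> ^^ i) ((\<partial>bar ^^ j) (\<lambda>w. trace (curvature h w)))) z"
    by (rule wirtinger_cong(1)[OF open_S dz.prems dz.IH])
  finally show ?case by simp
qed

end

section \<open>The curvature of the projection\<close>

lemma blinfun_compose_sum_left: "sum f I o\<^sub>L B = (\<Sum>i\<in>I. f i o\<^sub>L B)"
  by (rule blinfun_eqI) (simp add: blinfun.sum_left)

lemma blinfun_compose_sum_right: "B o\<^sub>L sum f I = (\<Sum>i\<in>I. B o\<^sub>L f i)"
  by (rule blinfun_eqI) (simp add: blinfun.sum_left blinfun.sum_right)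

lemmas blinfun_compose_add_left = bounded_bilinear.add_left[OF bounded_bilinear_blinfun_compose]
lemmas blinfun_compose_add_right = bounded_bilinear.add_right[OF bounded_bilinear_blinfun_compose]

lemma blinfun_compose_scaleC_left: "(c *\<^sub>C A) o\<^sub>L B = c *\<^sub>C (A o\<^sub>L B)"
  by (rule blinfun_eqI) (simp add: blinfun_apply_scaleC)

lemma blinfun_compose_scaleC_right:
  "B \<in> clinear_ops \<Longrightarrow> B o\<^sub>L (c *\<^sub>C A) = c *\<^sub>C (B o\<^sub>L A)"
  by (rule blinfun_eqI) (simp add: blinfun_apply_scaleC clinear_ops_def)

text \<open>\<open>M\<close> is the coefficient matrix of an operator between two families. They are
  kept separate because a derivative of the frame falls on one side only: \<partial> on the left,
  \<partial>bar on the right.\<close>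

definition frame_operator ::
    "complex ^ 'n ^ 'n \<Rightarrow> ('n::finite \<Rightarrow> 'a) \<Rightarrow> ('n \<Rightarrow> 'a) \<Rightarrow> 'a \<Rightarrow>\<^sub>L 'a::complex_hilbert_space" where
  "frame_operator M u v = (\<Sum>i\<in>UNIV. \<Sum>j\<in>UNIV. M $ i $ j *\<^sub>C rank_one (u i) (v j))"

lemma frame_operator_add: "frame_operator (M + N) u v = frame_operator M u v + frame_operator N u v"
  by (simp add: frame_operator_def scaleC_add_left sum.distrib)

lemma frame_operator_uminus: "frame_operator (- M) u v = - frame_operator M u v"
  by (simp add: frame_operator_def sum_negf)

lemma frame_operator_left:
  "frame_operator M (\<lambda>i. \<Sum>k\<in>UNIV. A $ k $ i *\<^sub>C u k) v = frame_operator (A ** M) u v"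
proof -
  have "frame_operator M (\<lambda>i. \<Sum>k\<in>UNIV. A $ k $ i *\<^sub>C u k) v
      = (\<Sum>i\<in>UNIV. \<Sum>j\<in>UNIV. \<Sum>k\<in>UNIV. (A $ k $ i * M $ i $ j) *\<^sub>C rank_one (u k) (v j))"
    by (simp add: frame_operator_def rank_one_sum_left rank_one_scaleC_left
        cvec.scale_sum_right mult.commute)
  also have "\<dots> = (\<Sum>i\<in>UNIV. \<Sum>k\<in>UNIV. \<Sum>j\<in>UNIV. (A $ k $ i * M $ i $ j) *\<^sub>C rank_one (u k) (v j))"
    by (rule sum.cong[OF refl]) (rule sum.swap)
  also have "\<dots> = (\<Sum>k\<in>UNIV. \<Sum>i\<in>UNIV. \<Sum>j\<in>UNIV. (A $ k $ i * M $ i $ j) *\<^sub>C rank_one (u k) (v j))"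
    by (rule sum.swap)
  also have "\<dots> = (\<Sum>k\<in>UNIV. \<Sum>j\<in>UNIV. \<Sum>i\<in>UNIV. (A $ k $ i * M $ i $ j) *\<^sub>C rank_one (u k) (v j))"
    by (rule sum.cong[OF refl]) (rule sum.swap)
  also have "\<dots> = frame_operator (A ** M) u v"
    by (simp add: frame_operator_def matrix_matrix_mult_def cvec.scale_sum_left)
  finally show ?thesis .
qed

text \<open>A change of the right family passes through the conjugate-linear argument of
  \<open>rank_one\<close>, hence the conjugate transpose.\<close>

lemma frame_operator_right:
  "frame_operator M u (\<lambda>j. \<Sum>k\<in>UNIV. A $ k $ j *\<^sub>C v k) = frame_operator (M ** conj_transpose A) u v"
proof -
  have "frame_operator M u (\<lambda>j. \<Sum>k\<in>UNIV. A $ k $ j *\<^sub>C v k)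
      = (\<Sum>i\<in>UNIV. \<Sum>j\<in>UNIV. \<Sum>k\<in>UNIV. (M $ i $ j * cnj (A $ k $ j)) *\<^sub>C rank_one (u i) (v k))"
    by (simp add: frame_operator_def rank_one_sum_right rank_one_scaleC_right
        cvec.scale_sum_right)
  also have "\<dots> = (\<Sum>i\<in>UNIV. \<Sum>k\<in>UNIV. \<Sum>j\<in>UNIV. (M $ i $ j * cnj (A $ k $ j)) *\<^sub>C rank_one (u i) (v k))"
    by (rule sum.cong[OF refl]) (rule sum.swap)
  also have "\<dots> = frame_operator (M ** conj_transpose A) u v"
    by (simp add: frame_operator_def matrix_matrix_mult_def conj_transpose_def cvec.scale_sum_left)
  finally show ?thesis .
qed

lemma rank_one_clinear: "rank_one u v \<in> clinear_ops"
  by (simp add: clinear_ops_def rank_one_apply cinner_scaleC_left scaleC_scaleC)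

text \<open>The inner families \<open>v\<close> and \<open>u'\<close> meet only through their inner
  products, so their Gram matrix becomes the middle factor.\<close>

lemma frame_operator_compose:
  "frame_operator M u v o\<^sub>L frame_operator N u' v'
    = frame_operator (M ** (\<chi> j k. cinner (u' k) (v j)) ** N) u v'"
proof -
  have "frame_operator M u v o\<^sub>L frame_operator N u' v'
      = (\<Sum>i\<in>UNIV. \<Sum>j\<in>UNIV. M $ i $ j *\<^sub>C (rank_one (u i) (v j) o\<^sub>L frame_operator N u' v'))"
    by (simp add: frame_operator_def[of M] blinfun_compose_sum_left blinfun_compose_scaleC_left)
  \<comment> \<open>A rank-one operator composed with the right factor is again rank one, with
    second vector a combination of \<open>v'\<close>. This is the shape to which
    \<open>frame_operator_right\<close> applies; its conjugate transpose undoes the one written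
    here.\<close>
  also have "\<dots> = (\<Sum>i\<in>UNIV. \<Sum>j\<in>UNIV. M $ i $ j *\<^sub>C
      rank_one (u i) (\<Sum>l\<in>UNIV. conj_transpose ((\<chi> j k. cinner (u' k) (v j)) ** N) $ l $ j *\<^sub>C v' l))"
  proof -
    have "rank_one a (v j) o\<^sub>L frame_operator N u' v' = rank_one a
        (\<Sum>l\<in>UNIV. conj_transpose ((\<chi> j k. cinner (u' k) (v j)) ** N) $ l $ j *\<^sub>C v' l)" for a j
    proof -
      have "rank_one a (v j) o\<^sub>L frame_operator N u' v'
          = (\<Sum>k\<in>UNIV. \<Sum>l\<in>UNIV. (cinner (u' k) (v j) * N $ k $ l) *\<^sub>C rank_one a (v' l))"
        by (simp add: frame_operator_def blinfun_compose_sum_right blinfun_compose_scaleC_right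
            rank_one_clinear rank_one_compose scaleC_scaleC mult.commute)
      also have "\<dots> = (\<Sum>l\<in>UNIV. \<Sum>k\<in>UNIV. (cinner (u' k) (v j) * N $ k $ l) *\<^sub>C rank_one a (v' l))"
        by (rule sum.swap)
      also have "\<dots> = rank_one a
          (\<Sum>l\<in>UNIV. conj_transpose ((\<chi> j k. cinner (u' k) (v j)) ** N) $ l $ j *\<^sub>C v' l)"
        by (simp add: rank_one_sum_right rank_one_scaleC_right conj_transpose_def
            matrix_matrix_mult_def cvec.scale_sum_left)
      finally show ?thesis .
    qed
    then show ?thesis by simp
  qed
  also have "\<dots> = frame_operator (M ** (\<chi> j k. cinner (u' k) (v j)) ** N) u v'"
    unfolding frame_operator_def[symmetric] frame_operator_right
    by (simp add: conj_transpose_def matrix_mul_assoc)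
  finally show ?thesis .
qed

lemma clinear_compose_frame_operator:
  assumes "Q \<in> clinear_ops"
  shows "Q o\<^sub>L frame_operator M u v = frame_operator M (\<lambda>i. blinfun_apply Q (u i)) v"
proof -
  have "Q o\<^sub>L rank_one a b = rank_one (blinfun_apply Q a) b" for a b
    using assms by (intro blinfun_eqI) (simp add: rank_one_apply clinear_ops_def)
  then show ?thesis
    by (simp add: frame_operator_def blinfun_compose_sum_right blinfun_compose_scaleC_right assms)
qed

text \<open>Self-adjointness moves \<open>Q\<close> from the argument to the vector it is paired
  with.\<close>

lemma frame_operator_compose_projection:
  assumes "orthogonal_projection Q V"
  shows "frame_operator M u v o\<^sub>L Q = frame_operator M u (\<lambda>j. blinfun_apply Q (v j))"
proof -
  have "rank_one a b o\<^sub>L Q = rank_one a (blinfun_apply Q b)" for a b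
    using assms by (intro blinfun_eqI) (simp add: rank_one_apply orthogonal_projection_def)
  then show ?thesis
    by (simp add: frame_operator_def blinfun_compose_sum_left blinfun_compose_scaleC_left)
qed

lemma frame_operator_diff_left:
  "frame_operator M (\<lambda>i. u i - u' i) v = frame_operator M u v - frame_operator M u' v"
  by (simp add: frame_operator_def rank_one_diff_left cvec.scale_right_diff_distrib sum_subtractf)

lemma frame_operator_diff_right:
  "frame_operator M u (\<lambda>i. v i - v' i) = frame_operator M u v - frame_operator M u v'"
  by (simp add: frame_operator_def rank_one_diff_right cvec.scale_right_diff_distrib sum_subtractf)

lemma has_wirtinger_frame_operator:
  assumes "has_wirtinger M a b z" "\<And>i. has_wirtinger (u i) (u' i) 0 z" "\<And>j. has_wirtinger (v j) (v' j) 0 z"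
  shows "has_wirtinger (\<lambda>w. frame_operator (M w) (\<lambda>i. u i w) (\<lambda>j. v j w))
    (frame_operator a (\<lambda>i. u i z) (\<lambda>j. v j z) + frame_operator (M z) u' (\<lambda>j. v j z))
    (frame_operator b (\<lambda>i. u i z) (\<lambda>j. v j z) + frame_operator (M z) (\<lambda>i. u i z) v') z"
  unfolding frame_operator_def sum.distrib[symmetric]
  by (intro has_wirtinger_sum has_wirtinger_scaleC has_wirtinger_component has_wirtinger_rank_one assms)

text \<open>By Parseval each rank-one term has trace <u_i, v_j>; the finite sum of these is the
  trace of \<open>M\<close> times the Gram matrix.\<close>

lemma frame_operator_trace_sums:
  assumes "orthonormal_basis \<sigma>"
  shows "(\<lambda>m. cinner (blinfun_apply (frame_operator M u v) (\<sigma> m)) (\<sigma> m)) sums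
    trace (M ** (\<chi> j i. cinner (u i) (v j)))"
proof -
  have "(\<lambda>m. \<Sum>i\<in>UNIV. \<Sum>j\<in>UNIV. M $ i $ j * (cinner (u i) (\<sigma> m) * cinner (\<sigma> m) (v j))) sums
      (\<Sum>i\<in>UNIV. \<Sum>j\<in>UNIV. M $ i $ j * cinner (u i) (v j))"
    by (intro sums_sum sums_mult orthonormal_basis_parseval assms)
  then show ?thesis
    by (simp add: frame_operator_def blinfun.sum_left blinfun_apply_scaleC rank_one_apply
        scaleC_scaleC cinner_sum_left cinner_scaleC_left trace_def matrix_matrix_mult_def mult_ac)
qed

section \<open>The projection expressed through a holomorphic frame\<close>

locale projected_frame =
  fixes S :: "complex set" and \<alpha> :: "'n::finite \<Rightarrow> complex \<Rightarrow> 'a::complex_hilbert_space"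
    and P :: "complex \<Rightarrow> 'a \<Rightarrow>\<^sub>L 'a"
  assumes open_S: "open S"
    and frame_holomorphic: "vholomorphic_on (\<alpha> i) S"
    and frame_inj: "z \<in> S \<Longrightarrow> inj (\<lambda>i. \<alpha> i z)"
    and frame_independent: "z \<in> S \<Longrightarrow> \<not> cdependent (range (\<lambda>i. \<alpha> i z))"
    and projection: "z \<in> S \<Longrightarrow> orthogonal_projection (P z) (cspan (range (\<lambda>i. \<alpha> i z)))"
begin

definition pairings :: "(complex \<Rightarrow> complex) set" where
  "pairings = {\<lambda>z. cinner (u z) (v z) | u v :: complex \<Rightarrow> 'a. vholomorphic_on u S \<and> vholomorphic_on v S}"

text \<open>In a pairing of holomorphic vectors \<partial> differentiates \<open>u\<close> and
  \<partial>bar differentiates \<open>v\<close>, and the results are holomorphic again. Both mixed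
  derivatives equal <\<partial> u, \<partial> v>.\<close>

sublocale wirtinger_closed S pairings
proof
  fix g
  assume "g \<in> pairings"
  then obtain u v :: "complex \<Rightarrow> 'a" where g: "g = (\<lambda>z. cinner (u z) (v z))"
    and uv: "vholomorphic_on u S" "vholomorphic_on v S"
    by (auto simp: pairings_def)
  note uv' = vholomorphic_on_wirt_d[OF open_S uv(1)] vholomorphic_on_wirt_d[OF open_S uv(2)]
  let ?a = "\<lambda>z. cinner (\<partial> u z) (v z)" and ?b = "\<lambda>z. cinner (u z) (\<partial> v z)"
  have "?a \<in> pairings" "?b \<in> pairings"
    using uv uv' by (auto simp: pairings_def)
  moreover have d: "\<exists>p c q. has_wirtinger g (?a z) (?b z) z \<and> has_wirtinger ?a p c z \<and> has_wirtinger ?b c q z"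
    if "z \<in> S" for z
  proof -
    have "has_wirtinger u (\<partial> u z) 0 z" "has_wirtinger v (\<partial> v z) 0 z"
      "has_wirtinger (\<partial> u) (\<partial> (\<partial> u) z) 0 z" "has_wirtinger (\<partial> v) (\<partial> (\<partial> v) z) 0 z"
      using uv uv' that by (simp_all add: vholomorphic_on_open[OF open_S])
    then show ?thesis
      unfolding g by (blast intro: has_wirtinger_cinner)
  qed
  ultimately show "\<exists>a\<in>pairings. \<exists>b\<in>pairings. \<forall>z\<in>S. \<exists>p c q.
      has_wirtinger g (a z) (b z) z \<and> has_wirtinger a p c z \<and> has_wirtinger b c q z"
    by (intro bexI[of _ ?a] bexI[of _ ?b] ballI)
qed (rule open_S)

abbreviation h :: "complex \<Rightarrow> complex ^ 'n ^ 'n" where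
  "h \<equiv> frame_metric \<alpha>"

abbreviation hi :: "complex \<Rightarrow> complex ^ 'n ^ 'n" where
  "hi z \<equiv> matrix_inv (h z)"

abbreviation frame_op :: "complex ^ 'n ^ 'n \<Rightarrow> complex \<Rightarrow> 'a \<Rightarrow>\<^sub>L 'a" where
  "frame_op M z \<equiv> frame_operator M (\<lambda>i. \<alpha> i z) (\<lambda>i. \<alpha> i z)"

lemma frame_has_wirtinger:
  assumes "z \<in> S"
  shows "has_wirtinger (\<alpha> i) (\<partial> (\<alpha> i) z) 0 z"
    "has_wirtinger (\<partial> (\<alpha> i)) (\<partial> (\<partial> (\<alpha> i)) z) 0 z"
  using frame_holomorphic[of i] vholomorphic_on_wirt_d[OF open_S frame_holomorphic[of i]] assms
  by (simp_all add: vholomorphic_on_open[OF open_S])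

lemma alg_metric: "alg_matrix h"
  unfolding alg_matrix_def frame_metric_def
  using frame_holomorphic by (auto simp: pairings_def intro!: wirtinger_algebra.generator)

lemma metric_has_wirtinger:
  assumes "z \<in> S"
  shows "has_wirtinger h (\<chi> i j. cinner (\<partial> (\<alpha> j) z) (\<alpha> i z)) (\<chi> i j. cinner (\<alpha> j z) (\<partial> (\<alpha> i) z)) z"
  unfolding frame_metric_def[abs_def]
  by (intro has_wirtinger_vec) (simp add: has_wirtinger_cinner frame_has_wirtinger assms)

text \<open>A kernel vector of the Gram matrix is the coordinate vector of some \<open>x\<close> in
  the span that is orthogonal to the whole frame, hence to itself; independence then makes the
  coordinates vanish.\<close>

lemma metric_invertible:
  assumes z: "z \<in> S"
  shows "invertible (h z)"
proof -
  have "v = 0" if v: "h z *v v = 0" for v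
  proof -
    define x where "x = (\<Sum>j\<in>UNIV. v $ j *\<^sub>C \<alpha> j z)"
    have "cinner x (\<alpha> i z) = 0" for i
    proof -
      have "cinner x (\<alpha> i z) = (h z *v v) $ i"
        by (simp add: x_def cinner_sum_left cinner_scaleC_left frame_metric_def
            matrix_vector_mult_def mult.commute)
      then show ?thesis by (simp add: v)
    qed
    then have "cinner x x = 0"
      by (subst (2) x_def) (simp add: cinner_sum_right cinner_scaleC_right)
    then have x: "x = 0" by (simp add: cinner_self_eq_0)
    \<comment> \<open>Independence is a property of the set of frame vectors, so the coefficients
      are reindexed by vectors through the inverse of the injective map \<open>?f\<close>.\<close>
    let ?f = "\<lambda>i. \<alpha> i z"
    have inv: "inv ?f (\<alpha> i z) = i" for i
      using inv_f_f[OF frame_inj[OF z], of i] .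
    have "(\<Sum>y\<in>range ?f. v $ inv ?f y *\<^sub>C y) = x"
      unfolding x_def using frame_inj[OF z] by (simp add: sum.reindex inv)
    then have sum0: "(\<Sum>y\<in>range ?f. v $ inv ?f y *\<^sub>C y) = 0" using x by simp
    have "v $ i = 0" for i
      using cvec.independentD[OF frame_independent[OF z] _ subset_refl sum0, of "?f i"]
      by (simp add: inv)
    then show "v = 0" by (simp add: vec_eq_iff)
  qed
  then show ?thesis
    by (simp add: invertible_left_inverse matrix_left_invertible_ker)
qed

lemmas metric_inverse = matrix_inv_mult[OF metric_invertible]

lemma conj_transpose_inverse_metric:
  assumes z: "z \<in> S"
  shows "conj_transpose (hi z) = hi z"
proof -
  have h: "conj_transpose (h z) = h z"
    by (simp add: conj_transpose_def frame_metric_def vec_eq_iff flip: cinner_commute)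
  have "conj_transpose (hi z) ** h z = conj_transpose (h z ** hi z)"
    by (simp only: conj_transpose_mult h)
  also have "\<dots> = mat 1"
    by (simp add: metric_inverse z conj_transpose_def mat_def vec_eq_iff)
  finally have "conj_transpose (hi z) ** (h z ** hi z) = hi z"
    by (simp add: matrix_mul_assoc)
  then show ?thesis by (simp add: metric_inverse z)
qed

text \<open>The coordinates of the projected vector solve the normal equations, whose matrix is
  \<open>h z\<close> and whose right side is the vector of products <x, \<alpha>_j>.\<close>

lemma projection_apply:
  assumes z: "z \<in> S"
  shows "blinfun_apply (P z) x
    = (\<Sum>i\<in>UNIV. (\<Sum>j\<in>UNIV. hi z $ i $ j * cinner x (\<alpha> j z)) *\<^sub>C \<alpha> i z)"
    (is "_ = ?y")
proof (rule projection_eqI[OF projection[OF z]])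
  let ?V = "cspan (range (\<lambda>i. \<alpha> i z))"
  show "?y \<in> ?V"
    by (intro cvec.span_sum cvec.span_scale cvec.span_base) simp
  have y: "cinner ?y (\<alpha> k z) = cinner x (\<alpha> k z)" for k
  proof -
    let ?c = "\<chi> j. cinner x (\<alpha> j z)"
    have "cinner ?y (\<alpha> k z) = (h z *v (hi z *v ?c)) $ k"
      by (simp add: cinner_sum_left cinner_scaleC_left frame_metric_def matrix_vector_mult_def
          mult.commute)
    also have "\<dots> = ?c $ k"
      by (simp only: matrix_vector_mul_assoc metric_inverse z matrix_vector_mul_lid)
    finally show ?thesis by simp
  qed
  show "cinner ?y m = cinner x m" if "m \<in> ?V" for m
    using that
  proof (induction rule: cvec.span_induct_alt)
    case (step c b m)
    then show ?case
      by (auto simp: cinner_add_right[of _ "c *\<^sub>C b"] cinner_scaleC_right y)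
  qed simp
qed (rule cvec.span_diff)

lemma projection_eq_frame_op:
  assumes "z \<in> S"
  shows "P z = frame_op (hi z) z"
  by (rule blinfun_eqI)
    (simp add: projection_apply assms frame_operator_def blinfun.sum_left blinfun_apply_scaleC
      rank_one_apply scaleC_scaleC cvec.scale_sum_left)

lemma projection_clinear: "z \<in> S \<Longrightarrow> P z \<in> clinear_ops"
  using projection by (simp add: orthogonal_projection_def)

lemma projection_frame:
  assumes "z \<in> S"
  shows "blinfun_apply (P z) (\<alpha> i z) = \<alpha> i z"
proof (rule projection_eqI[OF projection[OF assms]])
  show "\<alpha> i z \<in> cspan (range (\<lambda>i. \<alpha> i z))"
    by (rule cvec.span_base) simp
qed (simp_all add: cvec.span_diff)

text \<open>Since <\<partial>\<alpha>_k, \<alpha>_j> is the entry (j, k) of \<partial> h, the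
  coordinates given by \<open>projection_apply\<close> form column \<open>k\<close> of the
  connection matrix.\<close>

lemma projection_frame_derivative:
  assumes "z \<in> S"
  shows "blinfun_apply (P z) (\<partial> (\<alpha> k) z) = (\<Sum>i\<in>UNIV. connection h z $ i $ k *\<^sub>C \<alpha> i z)"
  by (simp add: projection_apply assms connection_def matrix_matrix_mult_def
      has_wirtinger_imp(1)[OF metric_has_wirtinger])

lemma conj_transpose_connection:
  assumes "z \<in> S"
  shows "conj_transpose (connection h z) = \<partial>bar h z ** hi z"
proof -
  have "conj_transpose (\<partial> h z) = \<partial>bar h z"
    by (simp add: has_wirtinger_imp[OF metric_has_wirtinger[OF assms]] conj_transpose_def vec_eq_iff
        flip: cinner_commute)
  then show ?thesis
    by (simp add: connection_def conj_transpose_mult conj_transpose_inverse_metric assms)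
qed

lemma inverse_metric_has_wirtinger:
  assumes z: "z \<in> S"
  shows "has_wirtinger hi (- (connection h z ** hi z)) (- (hi z ** \<partial>bar h z ** hi z)) z"
  using has_wirtinger_matrix_inv[OF open_S z metric_invertible alg_matrix_has_wirtinger[OF alg_metric z]]
    has_wirtinger_imp_differentiable[OF alg_matrix_has_wirtinger[OF
      alg_matrix_inv[OF alg_metric metric_invertible] z]]
  by (simp add: connection_def)

lemma frame_op_has_wirtinger:
  assumes "alg_matrix M" "z \<in> S"
  shows "has_wirtinger (\<lambda>w. frame_op (M w) w)
    (frame_op (\<partial> M z) z + frame_operator (M z) (\<lambda>i. \<partial> (\<alpha> i) z) (\<lambda>i. \<alpha> i z))
    (frame_op (\<partial>bar M z) z + frame_operator (M z) (\<lambda>i. \<alpha> i z) (\<lambda>i. \<partial> (\<alpha> i) z)) z"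
  by (intro has_wirtinger_frame_operator alg_matrix_has_wirtinger frame_has_wirtinger assms)

lemma cov_deriv_inverse_metric_has_wirtinger:
  assumes K: "cov_deriv h i j K" and z: "z \<in> S"
  shows "has_wirtinger (\<lambda>w. - K w ** hi w)
    (- \<partial> K z ** hi z + - K z ** - (connection h z ** hi z))
    (- \<partial>bar K z ** hi z + - K z ** - (hi z ** \<partial>bar h z ** hi z)) z"
  by (intro has_wirtinger_matrix_mult has_wirtinger_uminus inverse_metric_has_wirtinger
      alg_matrix_has_wirtinger alg_matrix_cov_deriv[OF alg_metric metric_invertible K] z)

lemma frame_op_cov_deriv:
  assumes K: "cov_deriv h i j K" and z: "z \<in> S"
  defines "M \<equiv> \<lambda>w. - K w ** hi w"
  shows "has_wirtinger (\<lambda>w. frame_op (M w) w)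
    (frame_op (\<partial> M z) z + frame_operator (M z) (\<lambda>i. \<partial> (\<alpha> i) z) (\<lambda>i. \<alpha> i z))
    (frame_op (\<partial>bar M z) z + frame_operator (M z) (\<lambda>i. \<alpha> i z) (\<lambda>i. \<partial> (\<alpha> i) z)) z"
  unfolding M_def
  by (intro frame_op_has_wirtinger alg_matrix_mult alg_matrix_uminus alg_matrix_inv alg_metric
      metric_invertible alg_matrix_cov_deriv[OF alg_metric metric_invertible K] z)

section \<open>Matching the derivatives of the projection with those of the curvature\<close>

text \<open>Both derivatives of \<open>P\<close> involve only the parts \<open>?\<beta>\<close> of
  \<partial>\<alpha>_i orthogonal to the fibre, one on the left and one on the right. Their product
  therefore contains the Gram matrix of \<open>?\<beta>\<close>, which is \<open>h\<close> times
  \<partial>bar of the connection.\<close>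

lemma curve_curvature_base:
  assumes z: "z \<in> S"
  shows "\<partial>bar P z o\<^sub>L \<partial> P z = frame_op (- curvature h z ** hi z) z"
proof -
  let ?\<theta> = "connection h z"
  let ?\<beta> = "\<lambda>i. \<partial> (\<alpha> i) z - blinfun_apply (P z) (\<partial> (\<alpha> i) z)"
  \<comment> \<open>This matrix is \<partial>bar \<partial> h, as shown in \<open>d\<close>
    below.\<close>
  let ?D = "\<chi> j k. cinner (\<partial> (\<alpha> k) z) (\<partial> (\<alpha> j) z)"
  note hi = inverse_metric_has_wirtinger[OF z]
  note F = frame_op_has_wirtinger[OF alg_matrix_inv[OF alg_metric metric_invertible] z,
      unfolded has_wirtinger_imp[OF hi]]
  have dP: "\<partial> P z = frame_operator (hi z) ?\<beta> (\<lambda>i. \<alpha> i z)"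
    using wirtinger_cong(1)[OF open_S z projection_eq_frame_op] has_wirtinger_imp(1)[OF F]
    by (simp add: frame_operator_diff_left projection_frame_derivative z frame_operator_left
        frame_operator_uminus)
  \<comment> \<open>Identifies the term that comes from differentiating the inverse metric as the
    one that subtracts from \<partial>\<alpha>_j its projection.\<close>
  have "hi z ** conj_transpose ?\<theta> = hi z ** \<partial>bar h z ** hi z"
    by (simp add: conj_transpose_connection z matrix_mul_assoc)
  then have dbarP: "\<partial>bar P z = frame_operator (hi z) (\<lambda>i. \<alpha> i z) ?\<beta>"
    using wirtinger_cong(2)[OF open_S z projection_eq_frame_op] has_wirtinger_imp(2)[OF F]
    by (simp add: frame_operator_diff_right projection_frame_derivative z frame_operator_right
        frame_operator_uminus)
  have N: "(\<chi> j k. cinner (?\<beta> k) (?\<beta> j)) = ?D - \<partial>bar h z ** ?\<theta>"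
  proof -
    have "cinner (?\<beta> k) (?\<beta> j) = cinner (\<partial> (\<alpha> k) z) (\<partial> (\<alpha> j) z)
        - (\<Sum>l\<in>UNIV. cinner (\<alpha> l z) (\<partial> (\<alpha> j) z) * ?\<theta> $ l $ k)" for j k
    proof -
      have "blinfun_apply (P z) (\<partial> (\<alpha> j) z) \<in> cspan (range (\<lambda>i. \<alpha> i z))"
        using projection[OF z] by (auto simp: orthogonal_projection_def)
      \<comment> \<open>\<open>?\<beta> k\<close> is orthogonal to the fibre, so the projected part
        of the second argument drops out.\<close>
      then have "cinner (?\<beta> k) (blinfun_apply (P z) (\<partial> (\<alpha> j) z)) = 0"
        by (simp add: cinner_diff_left projection_cinner_eq[OF projection[OF z]])
      then have "cinner (?\<beta> k) (?\<beta> j)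
          = cinner (\<partial> (\<alpha> k) z) (\<partial> (\<alpha> j) z) - cinner (blinfun_apply (P z) (\<partial> (\<alpha> k) z)) (\<partial> (\<alpha> j) z)"
        by (simp add: cinner_diff_right cinner_diff_left)
      then show ?thesis
        by (simp add: projection_frame_derivative z cinner_sum_left cinner_scaleC_left mult.commute)
    qed
    then show ?thesis
      by (simp add: vec_eq_iff matrix_matrix_mult_def has_wirtinger_imp[OF metric_has_wirtinger[OF z]])
  qed
  have d: "has_wirtinger (\<partial> h) (\<partial> (\<partial> h) z) ?D z"
  proof -
    have "has_wirtinger (\<lambda>w. \<chi> i j. cinner (\<partial> (\<alpha> j) w) (\<alpha> i w))
        (\<chi> i j. cinner (\<partial> (\<partial> (\<alpha> j)) z) (\<alpha> i z)) ?D z"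
      by (intro has_wirtinger_vec) (simp add: has_wirtinger_cinner frame_has_wirtinger z)
    then have "has_wirtinger (\<partial> h) (\<chi> i j. cinner (\<partial> (\<partial> (\<alpha> j)) z) (\<alpha> i z)) ?D z"
      by (subst has_wirtinger_cong[OF open_S z has_wirtinger_imp(1)[OF metric_has_wirtinger]])
    then show ?thesis
      by (simp only: has_wirtinger_imp(1))
  qed
  have "- curvature h z = - (hi z ** \<partial>bar h z ** hi z) ** \<partial> h z + hi z ** ?D"
    using has_wirtinger_imp(2)[OF has_wirtinger_matrix_mult[OF hi d]]
    by (simp add: curvature_def connection_def[abs_def])
  also have "\<dots> = hi z ** (?D - \<partial>bar h z ** ?\<theta>)"
    by (simp add: matrix_mult_distrib connection_def matrix_mult_uminus matrix_mul_assoc)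
  finally show ?thesis
    by (simp add: dP dbarP frame_operator_compose N)
qed

lemma curve_curvature_frame_op:
  "curve_curvature P i j X \<Longrightarrow>
    \<exists>K. cov_deriv h i j K \<and> (\<forall>z\<in>S. X z = frame_op (- K z ** hi z) z)"
proof (induction rule: curve_curvature.induct)
  case base
  then show ?case
    using curve_curvature_base cov_deriv.base by blast
next
  case (dz i j X)
  then obtain K where K: "cov_deriv h i j K" and X: "\<And>z. z \<in> S \<Longrightarrow> X z = frame_op (- K z ** hi z) z"
    by blast
  have "P z o\<^sub>L \<partial> X z = frame_op (- (\<partial> K z + commutator (connection h z) (K z)) ** hi z) z"
    if z: "z \<in> S" for z
  proof -
    let ?M = "\<lambda>w. - K w ** hi w" and ?\<theta> = "connection h z"
    \<comment> \<open>\<open>P z\<close> fixes the frame and sends \<partial>\<alpha>_i back into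
      the fibre with the columns of \<open>?\<theta>\<close> as coordinates; this adds
      \<open>?\<theta> ** ?M z\<close>.\<close>
    have "P z o\<^sub>L \<partial> X z = frame_op (\<partial> ?M z + ?\<theta> ** ?M z) z"
      using wirtinger_cong(1)[OF open_S z X] has_wirtinger_imp(1)[OF frame_op_cov_deriv[OF K z]]
      by (simp add: blinfun_compose_add_right clinear_compose_frame_operator projection_clinear projection_frame
          projection_frame_derivative z frame_operator_left frame_operator_add)
    \<comment> \<open>Differentiating the inverse metric contributes K \<theta>, and the added term
      contributes - \<theta> K: together they are minus the commutator.\<close>
    also have "\<partial> ?M z + ?\<theta> ** ?M z = - (\<partial> K z + commutator ?\<theta> (K z)) ** hi z"
      unfolding has_wirtinger_imp(1)[OF cov_deriv_inverse_metric_has_wirtinger[OF K z]]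
      by (simp add: commutator_def matrix_mult_uminus matrix_mult_distrib
          matrix_mul_assoc)
    finally show ?thesis .
  qed
  then show ?case
    using cov_deriv.dz[OF K] by blast
next
  case (dzbar i j X)
  then obtain K where K: "cov_deriv h i j K" and X: "\<And>z. z \<in> S \<Longrightarrow> X z = frame_op (- K z ** hi z) z"
    by blast
  have "\<partial>bar X z o\<^sub>L P z = frame_op (- \<partial>bar K z ** hi z) z" if z: "z \<in> S" for z
  proof -
    let ?M = "\<lambda>w. - K w ** hi w"
    have "\<partial>bar X z o\<^sub>L P z = frame_op (\<partial>bar ?M z + ?M z ** (\<partial>bar h z ** hi z)) z"
      using wirtinger_cong(2)[OF open_S z X] has_wirtinger_imp(2)[OF frame_op_cov_deriv[OF K z]]
      by (simp add: blinfun_compose_add_left frame_operator_compose_projection[OF projection] projection_frame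
          projection_frame_derivative z frame_operator_right frame_operator_add
          conj_transpose_connection)
    \<comment> \<open>The term added by the projection cancels the derivative of the inverse metric,
      so only \<partial>bar K survives.\<close>
    also have "\<partial>bar ?M z + ?M z ** (\<partial>bar h z ** hi z) = - \<partial>bar K z ** hi z"
      unfolding has_wirtinger_imp(2)[OF cov_deriv_inverse_metric_has_wirtinger[OF K z]]
      by (simp add: matrix_mult_uminus matrix_mul_assoc)
    finally show ?thesis .
  qed
  then show ?case
    using cov_deriv.dzbar[OF K] by blast
qed

lemma curve_curvature_trace_sums:
  assumes "orthonormal_basis \<sigma>" and X: "curve_curvature P i j X" and K: "cov_deriv h i j K" and z: "z \<in> S"
  shows "(\<lambda>m. cinner (blinfun_apply (X z) (\<sigma> m)) (\<sigma> m)) sums (- trace (K z))"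
proof -
  obtain L where L: "cov_deriv h i j L" and X_eq: "X z = frame_op (- L z ** hi z) z"
    using curve_curvature_frame_op[OF X] z by blast
  \<comment> \<open>The Gram matrix of the frame is the metric itself, which cancels
    \<open>hi z\<close>.\<close>
  have "(- L z ** hi z) ** (\<chi> j i. cinner (\<alpha> i z) (\<alpha> j z)) = - L z"
    by (simp add: metric_inverse z flip: frame_metric_def matrix_mul_assoc)
  then have "(\<lambda>m. cinner (blinfun_apply (X z) (\<sigma> m)) (\<sigma> m)) sums trace (- L z)"
    using frame_operator_trace_sums[OF assms(1), of "- L z ** hi z" "\<lambda>i. \<alpha> i z" "\<lambda>i. \<alpha> i z"]
    by (simp add: X_eq)
  \<comment> \<open>\<open>L\<close> follows the order of differentiation used for \<open>X\<close>,
    whereas \<open>K\<close> may follow another; both have the same normal form of the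
    trace.\<close>
  also have "trace (- L z) = - trace (K z)"
    using trace_cov_deriv[OF alg_metric metric_invertible L z]
      trace_cov_deriv[OF alg_metric metric_invertible K z]
    by (simp add: trace_def sum_negf)
  finally show ?thesis .
qed

end

theorem proposition4p4:
  fixes \<Omega> :: "complex set"
    and T :: "'a::{complex_hilbert_space, second_countable_topology} \<Rightarrow>\<^sub>L 'a"
    and P :: "complex \<Rightarrow> 'a \<Rightarrow>\<^sub>L 'a"
    and \<alpha> :: "'n::finite \<Rightarrow> complex \<Rightarrow> 'a"
    and \<sigma> :: "nat \<Rightarrow> 'a"
    and s t :: nat
    and X :: "complex \<Rightarrow> 'a \<Rightarrow>\<^sub>L 'a"
    and K :: "complex \<Rightarrow> complex ^ 'n ^ 'n"
    and z :: complex
  assumes "open \<Omega>" "connected \<Omega>" "bounded \<Omega>"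
    and "T \<in> cowen_douglas CARD('n) \<Omega>"
    and "\<And>\<mu>. \<mu> \<in> \<Omega> \<Longrightarrow> orthogonal_projection (P \<mu>) (eigenspace T \<mu>)"
    and "holomorphic_frame \<alpha> T \<Omega>"
    and "orthonormal_basis \<sigma>"
    and "s \<le> CARD('n)" "t \<le> CARD('n)"
    and "curve_curvature P s t X"
    and "cov_deriv (frame_metric \<alpha>) s t K"
    and "z \<in> \<Omega>"
  shows "(\<lambda>i. cinner (blinfun_apply (X z) (\<sigma> i)) (\<sigma> i)) sums (- trace (K z))"
proof -
  \<comment> \<open>The eigenspace of \<open>T\<close> is the span of the frame at each point, so
    \<open>P\<close> projects onto that span.\<close>
  interpret projected_frame \<Omega> \<alpha> P
    using assms(1,5,6) by unfold_locales (auto simp: holomorphic_frame_def)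
  show ?thesis
    using assms(7,10-12) by (rule curve_curvature_trace_sums)
qed

end
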